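(* Let $\mathcal{K}$ be a complete discrete valued field of characteristic zero with uniformizer $2$ and residue field $\kappa\cong\mathbb{F}_2(\mathfrak{a},\mathfrak{b})$, where $\mathfrak{a},\mathfrak{b}$ are algebraically independent (purely transcendental) over $\mathbb{F}_2$. Let $a,b\in\mathcal{O}_{\mathcal{K}}$ be lifts of $\mathfrak{a},\mathfrak{b}$ and $\mathcal{L}=\mathcal{K}(\sqrt{a},\sqrt{b},\sqrt{2})$ (a pseudo-perfect extension of level one of $\mathcal{K}$). Then the natural restriction map $\mathrm{Res}^2_{\mathcal{L}/\mathcal{K}}:K_2(\mathcal{K})/2\to K_2(\mathcal{L})/2$ is not zero.
   Context: $K_2$ denotes the second Milnor $K$-group. *)

theory Defs
  imports
    "HOL-Algebra.Algebraic_Closure_Type"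
    "HOL-Algebra.Generated_Fields"
    "HOL-Algebra.Free_Abelian_Groups"
    "HOL-Algebra.QuotRing"
    "HOL-Computational_Algebra.Polynomial"
    "HOL-Computational_Algebra.Fraction_Field"
    "HOL-Library.Z2"
begin

section \<open>Complete discrete valued fields\<close>

text \<open>
  A normalised discrete valuation. The value at \<open>0\<close> (mathematically \<open>\<infinity>\<close>) is irrelevant: every use
  of \<open>v\<close> treats \<open>0\<close> separately. Surjectivity onto the integers makes the uniformizers
  exactly the elements of valuation \<open>1\<close>.
\<close>

locale discrete_valued_field =
  fixes v :: "'a::field \<Rightarrow> int"
  assumes val_mult: "x \<noteq> 0 \<Longrightarrow> y \<noteq> 0 \<Longrightarrow> v (x * y) = v x + v y"
    and val_add: "x \<noteq> 0 \<Longrightarrow> y \<noteq> 0 \<Longrightarrow> x + y \<noteq> 0 \<Longrightarrow> min (v x) (v y) \<le> v (x + y)"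
    and val_surj: "v ` (UNIV - {0}) = UNIV"

definition val_ge :: "('a::field \<Rightarrow> int) \<Rightarrow> int \<Rightarrow> 'a \<Rightarrow> bool"
  where "val_ge v n x \<longleftrightarrow> x = 0 \<or> n \<le> v x"

definition val_Cauchy :: "('a::field \<Rightarrow> int) \<Rightarrow> (nat \<Rightarrow> 'a) \<Rightarrow> bool"
  where "val_Cauchy v s \<longleftrightarrow> (\<forall>n. \<exists>N. \<forall>i\<ge>N. \<forall>j\<ge>N. val_ge v n (s i - s j))"

definition val_converges :: "('a::field \<Rightarrow> int) \<Rightarrow> (nat \<Rightarrow> 'a) \<Rightarrow> 'a \<Rightarrow> bool"
  where "val_converges v s l \<longleftrightarrow> (\<forall>n. \<exists>N. \<forall>i\<ge>N. val_ge v n (s i - l))"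

locale complete_discrete_valued_field = discrete_valued_field +
  assumes val_complete: "val_Cauchy v s \<Longrightarrow> \<exists>l. val_converges v s l"

definition valuation_ring :: "('a::field \<Rightarrow> int) \<Rightarrow> 'a ring"
  where "valuation_ring v = ring_of_type_algebra\<lparr>carrier := {x. val_ge v 0 x}\<rparr>"

definition valuation_ideal :: "('a::field \<Rightarrow> int) \<Rightarrow> 'a set"
  where "valuation_ideal v = {x. val_ge v 1 x}"

definition residue_field :: "('a::field \<Rightarrow> int) \<Rightarrow> 'a set ring"
  where "residue_field v = valuation_ring v Quot valuation_ideal v"

definition residue_class :: "('a::field \<Rightarrow> int) \<Rightarrow> 'a \<Rightarrow> 'a set"
  where "residue_class v x = valuation_ideal v +>\<^bsub>valuation_ring v\<^esub> x"

text \<open>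
  The rational function field in two indeterminates over the field with two elements, as the
  fraction field of \<open>\<bbbF>\<^sub>2[\<aa>][\<bb>]\<close>.
\<close>

type_synonym F2_rat2 = "bit poly poly fract"

definition F2_indet_a :: F2_rat2
  where "F2_indet_a = Fract [:[:0, 1:]:] 1"

definition F2_indet_b :: F2_rat2
  where "F2_indet_b = Fract [:0, 1:] 1"

section \<open>The second Milnor K-group\<close>

text \<open>
  \<open>K\<^sub>2(F)\<close> is the quotient of \<open>F\<^sup>\<times> \<otimes>\<^sub>\<int> F\<^sup>\<times>\<close> by the Steinberg relations \<open>x \<otimes> (1 - x)\<close>. The tensor product
  is presented, as usual, as the free abelian group on pairs modulo bilinearity. The group \<open>F\<^sup>\<times>\<close>
  is written multiplicatively, the free abelian group additively; as HOL-Algebra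
  groups, \<open>K\<^sub>2\<close> and its quotients are written multiplicatively.
\<close>

definition symbol_group :: "'a::field itself \<Rightarrow> ('a \<times> 'a \<Rightarrow>\<^sub>0 int) monoid"
  where "symbol_group _ = free_Abelian_group ((UNIV - {0}) \<times> (UNIV - {0}))"

definition milnor_relations :: "'a::field itself \<Rightarrow> ('a \<times> 'a \<Rightarrow>\<^sub>0 int) set"
  where "milnor_relations _ =
      {frag_of (x * y, z) - frag_of (x, z) - frag_of (y, z) | x y z. x \<noteq> 0 \<and> y \<noteq> 0 \<and> z \<noteq> 0}
    \<union> {frag_of (x, y * z) - frag_of (x, y) - frag_of (x, z) | x y z. x \<noteq> 0 \<and> y \<noteq> 0 \<and> z \<noteq> 0}
    \<union> {frag_of (x, 1 - x) | x. x \<noteq> 0 \<and> x \<noteq> 1}"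

definition milnor_subgroup :: "'a::field itself \<Rightarrow> ('a \<times> 'a \<Rightarrow>\<^sub>0 int) set"
  where "milnor_subgroup T = generate (symbol_group T) (milnor_relations T)"

definition milnor_K2 :: "'a::field itself \<Rightarrow> ('a \<times> 'a \<Rightarrow>\<^sub>0 int) set monoid"
  where "milnor_K2 T = symbol_group T Mod milnor_subgroup T"

definition milnor_symbol :: "'a::field \<Rightarrow> 'a \<Rightarrow> ('a \<times> 'a \<Rightarrow>\<^sub>0 int) set"
  where "milnor_symbol x y =
    milnor_subgroup TYPE('a) #>\<^bsub>symbol_group TYPE('a)\<^esub> frag_of (x, y)"

text \<open>The subgroup \<open>2G\<close> of an abelian group \<open>G\<close>, in multiplicative notation.\<close>

definition doubles :: "('g, 'm) monoid_scheme \<Rightarrow> 'g set"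
  where "doubles G = (\<lambda>x. x [^]\<^bsub>G\<^esub> (2::nat)) ` carrier G"

definition milnor_K2_mod2 :: "'a::field itself \<Rightarrow> ('a \<times> 'a \<Rightarrow>\<^sub>0 int) set set monoid"
  where "milnor_K2_mod2 T = milnor_K2 T Mod doubles (milnor_K2 T)"

section \<open>Restriction along a field embedding\<close>

text \<open>
  The map \<open>G/M \<rightarrow> H/N\<close> induced by a homomorphism \<open>f : G \<rightarrow> H\<close> with \<open>f(M) \<subseteq> N\<close>: all the
  cosets \<open>N f(x)\<close>, for \<open>x\<close> in a fixed coset of \<open>M\<close>, coincide.
\<close>

definition quot_map :: "('h, 'n) monoid_scheme \<Rightarrow> 'h set \<Rightarrow> ('g \<Rightarrow> 'h) \<Rightarrow> 'g set \<Rightarrow> 'h set"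
  where "quot_map H N f C = (\<Union>x\<in>C. N #>\<^bsub>H\<^esub> f x)"

lemma quot_map_coset:
  assumes "group G" "group H" "f \<in> hom G H" "subgroup M G" "subgroup N H"
    and sub: "f ` M \<subseteq> N" and x: "x \<in> carrier G"
  shows "quot_map H N f (M #>\<^bsub>G\<^esub> x) = N #>\<^bsub>H\<^esub> f x"
proof -
  interpret G: group G by fact
  interpret H: group H by fact
  interpret M: subgroup M G by fact
  interpret N: subgroup N H by fact
  have "N #>\<^bsub>H\<^esub> f (m \<otimes>\<^bsub>G\<^esub> x) = N #>\<^bsub>H\<^esub> f x" if m: "m \<in> M" for m
  proof -
    have "f (m \<otimes>\<^bsub>G\<^esub> x) = f m \<otimes>\<^bsub>H\<^esub> f x"
      using assms m by (simp add: hom_mult M.mem_carrier)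
    moreover have "f m \<in> N" using sub m by blast
    moreover have "f x \<in> carrier H" using assms(3) x by (auto simp: hom_def)
    ultimately show ?thesis
      using H.coset_mult_assoc[of N "f m" "f x"] H.coset_join2[of "f m" N] assms(5) N.subset
      by (simp add: N.mem_carrier)
  qed
  moreover have "M \<noteq> {}" using M.one_closed by blast
  ultimately show ?thesis
    unfolding quot_map_def r_coset_def[of G M] by auto
qed

lemma quot_map_hom:
  assumes "group G" "group H" "f \<in> hom G H" "M \<lhd> G" "N \<lhd> H" and sub: "f ` M \<subseteq> N"
  shows "quot_map H N f \<in> hom (G Mod M) (H Mod N)"
proof -
  interpret G: group G by fact
  interpret H: group H by fact
  interpret M: normal M G by fact
  interpret N: normal N H by fact
  note q = quot_map_coset[OF assms(1-3) M.subgroup_axioms N.subgroup_axioms sub]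
  have f: "f x \<in> carrier H" if "x \<in> carrier G" for x
    using assms(3) that by (auto simp: hom_def)
  show ?thesis
    by (rule homI)
      (auto simp: FactGroup_def RCOSETS_def q f M.rcos_sum N.rcos_sum hom_mult[OF assms(3)])
qed

definition symbol_group_map :: "('a::field \<Rightarrow> 'b::field) \<Rightarrow> ('a \<times> 'a \<Rightarrow>\<^sub>0 int) \<Rightarrow> ('b \<times> 'b \<Rightarrow>\<^sub>0 int)"
  where "symbol_group_map \<iota> = frag_extend (\<lambda>(x, y). frag_of (\<iota> x, \<iota> y))"

definition restriction_K2 ::
    "('a::field \<Rightarrow> 'b::field) \<Rightarrow> ('a \<times> 'a \<Rightarrow>\<^sub>0 int) set \<Rightarrow> ('b \<times> 'b \<Rightarrow>\<^sub>0 int) set"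
  where "restriction_K2 \<iota> =
    quot_map (symbol_group TYPE('b)) (milnor_subgroup TYPE('b)) (symbol_group_map \<iota>)"

definition restriction_K2_mod2 ::
    "('a::field \<Rightarrow> 'b::field) \<Rightarrow> ('a \<times> 'a \<Rightarrow>\<^sub>0 int) set set \<Rightarrow> ('b \<times> 'b \<Rightarrow>\<^sub>0 int) set set"
  where "restriction_K2_mod2 \<iota> =
    quot_map (milnor_K2 TYPE('b)) (doubles (milnor_K2 TYPE('b))) (restriction_K2 \<iota>)"

definition field_embedding :: "('a::field \<Rightarrow> 'b::field) \<Rightarrow> bool"
  where "field_embedding \<iota> \<longleftrightarrow> \<iota> \<in> ring_hom ring_of_type_algebra ring_of_type_algebra"

text \<open>
  For a field embedding the restriction maps are well-defined homomorphisms, and they send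
  the symbol of \<open>x, y\<close> to the symbol of their images.
\<close>

lemma field_embedding_simps:
  assumes "field_embedding \<iota>"
  shows "\<iota> (x * y) = \<iota> x * \<iota> y" "\<iota> (x + y) = \<iota> x + \<iota> y" "\<iota> 1 = 1" "\<iota> 0 = 0"
    "\<iota> (x - y) = \<iota> x - \<iota> y" "\<iota> x = 0 \<longleftrightarrow> x = 0" "\<iota> x = 1 \<longleftrightarrow> x = 1"
proof -
  have m: "\<iota> (x * y) = \<iota> x * \<iota> y" and a: "\<iota> (x + y) = \<iota> x + \<iota> y" and o: "\<iota> 1 = 1" for x y
    using assms by (auto simp: field_embedding_def ring_hom_def ring_of_type_algebra_def)
  have z: "\<iota> 0 = 0" using a[of 0 0] by (metis add.right_neutral add_left_cancel)
  have d: "\<iota> (x - y) = \<iota> x - \<iota> y" for x y using a[of "x - y" y] by (simp add: algebra_simps)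
  have i: "\<iota> x = 0 \<longleftrightarrow> x = 0" for x
    using m[of x "inverse x"] o z by (cases "x = 0") auto
  show "\<iota> (x * y) = \<iota> x * \<iota> y" "\<iota> (x + y) = \<iota> x + \<iota> y" "\<iota> 1 = 1" "\<iota> 0 = 0"
    "\<iota> (x - y) = \<iota> x - \<iota> y" "\<iota> x = 0 \<longleftrightarrow> x = 0"
    by (rule m a o z d i)+
  show "\<iota> x = 1 \<longleftrightarrow> x = 1" using i[of "x - 1"] d[of x 1] o by simp
qed

lemma comm_group_symbol_group: "comm_group (symbol_group T)"
  by (simp add: symbol_group_def abelian_free_Abelian_group)

lemma milnor_relations_carrier: "milnor_relations T \<subseteq> carrier (symbol_group T)"
proof -
  have "frag_of p - frag_of q - frag_of r \<in> carrier (free_Abelian_group S)"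
    if "p \<in> S" "q \<in> S" "r \<in> S" for p q r :: "'a \<times> 'a" and S
    using that keys_diff[of "frag_of p - frag_of q" "frag_of r"]
      keys_diff[of "frag_of p" "frag_of q"] by auto
  then show ?thesis
    unfolding milnor_relations_def symbol_group_def
    by (auto simp del: carrier_free_Abelian_group_iff)
qed

lemma normal_milnor_subgroup: "milnor_subgroup T \<lhd> symbol_group T"
proof -
  interpret comm_group "symbol_group T" by (rule comm_group_symbol_group)
  show ?thesis
    unfolding milnor_subgroup_def
    by (intro subgroup_imp_normal generate_is_subgroup milnor_relations_carrier)
qed

lemma comm_group_milnor_K2: "comm_group (milnor_K2 T)"
proof -
  interpret comm_group "symbol_group T" by (rule comm_group_symbol_group)
  show ?thesis
    unfolding milnor_K2_def
    by (rule abelian_FactGroup) (rule normal_imp_subgroup[OF normal_milnor_subgroup])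
qed

lemma normal_doubles:
  assumes "comm_group G"
  shows "doubles G \<lhd> G"
proof -
  interpret comm_group G by fact
  have "subgroup (doubles G) G"
  proof (rule subgroupI)
    fix x y assume "x \<in> doubles G" "y \<in> doubles G"
    then show "x \<otimes>\<^bsub>G\<^esub> y \<in> doubles G"
      by (auto simp: doubles_def m_comm simp flip: pow_mult_distrib)
  next
    fix x assume "x \<in> doubles G"
    then show "inv\<^bsub>G\<^esub> x \<in> doubles G"
      by (auto simp: doubles_def simp flip: nat_pow_inv)
  qed (auto simp: doubles_def)
  then show ?thesis by (rule subgroup_imp_normal)
qed

lemma symbol_group_map_hom:
  assumes "field_embedding \<iota>"
  shows "symbol_group_map \<iota> \<in> hom (symbol_group TYPE('a::field)) (symbol_group TYPE('b::field))"
proof (rule homI)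
  fix c assume "c \<in> carrier (symbol_group TYPE('a))"
  then show "symbol_group_map \<iota> c \<in> carrier (symbol_group TYPE('b))"
    using keys_frag_extend[of "\<lambda>(x, y). frag_of (\<iota> x, \<iota> y)" c]
    by (fastforce simp: symbol_group_def symbol_group_map_def field_embedding_simps[OF assms])
qed (simp add: symbol_group_def symbol_group_map_def frag_extend_add)

lemma symbol_group_map_relations:
  fixes \<iota> :: "'a::field \<Rightarrow> 'b::field"
  assumes "field_embedding \<iota>"
  shows "symbol_group_map \<iota> ` milnor_subgroup TYPE('a) \<subseteq> milnor_subgroup TYPE('b)"
proof -
  interpret G: comm_group "symbol_group TYPE('a)" by (rule comm_group_symbol_group)
  interpret H: comm_group "symbol_group TYPE('b)" by (rule comm_group_symbol_group)
  interpret h: group_hom "symbol_group TYPE('a)" "symbol_group TYPE('b)" "symbol_group_map \<iota>"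
    by unfold_locales (rule symbol_group_map_hom[OF assms])
  have "symbol_group_map \<iota> ` milnor_relations TYPE('a) \<subseteq> milnor_relations TYPE('b)"
  proof (rule image_subsetI)
    fix r assume "r \<in> milnor_relations TYPE('a)"
    then consider
        x y z where "x \<noteq> 0" "y \<noteq> 0" "z \<noteq> 0"
          "r = frag_of (x * y, z) - frag_of (x, z) - frag_of (y, z)"
      | x y z where "x \<noteq> 0" "y \<noteq> 0" "z \<noteq> 0"
          "r = frag_of (x, y * z) - frag_of (x, y) - frag_of (x, z)"
      | x where "x \<noteq> 0" "x \<noteq> 1" "r = frag_of (x, 1 - x)"
      unfolding milnor_relations_def by blast
    then show "symbol_group_map \<iota> r \<in> milnor_relations TYPE('b)"
    proof cases
      case 1
      then have "symbol_group_map \<iota> r =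
          frag_of (\<iota> x * \<iota> y, \<iota> z) - frag_of (\<iota> x, \<iota> z) - frag_of (\<iota> y, \<iota> z)"
        by (simp add: symbol_group_map_def frag_extend_diff field_embedding_simps[OF assms])
      moreover have "\<iota> x \<noteq> 0" "\<iota> y \<noteq> 0" "\<iota> z \<noteq> 0"
        using 1 by (simp_all add: field_embedding_simps[OF assms])
      ultimately show ?thesis unfolding milnor_relations_def by blast
    next
      case 2
      then have "symbol_group_map \<iota> r =
          frag_of (\<iota> x, \<iota> y * \<iota> z) - frag_of (\<iota> x, \<iota> y) - frag_of (\<iota> x, \<iota> z)"
        by (simp add: symbol_group_map_def frag_extend_diff field_embedding_simps[OF assms])
      moreover have "\<iota> x \<noteq> 0" "\<iota> y \<noteq> 0" "\<iota> z \<noteq> 0"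
        using 2 by (simp_all add: field_embedding_simps[OF assms])
      ultimately show ?thesis unfolding milnor_relations_def by blast
    next
      case 3
      then have "symbol_group_map \<iota> r = frag_of (\<iota> x, 1 - \<iota> x)"
        by (simp add: symbol_group_map_def field_embedding_simps[OF assms])
      moreover have "\<iota> x \<noteq> 0" "\<iota> x \<noteq> 1"
        using 3 by (simp_all add: field_embedding_simps[OF assms])
      ultimately show ?thesis unfolding milnor_relations_def by blast
    qed
  qed
  then show ?thesis
    unfolding milnor_subgroup_def h.generate_img[OF milnor_relations_carrier, symmetric]
    by (rule H.mono_generate)
qed

lemma restriction_K2_hom:
  fixes \<iota> :: "'a::field \<Rightarrow> 'b::field"
  assumes "field_embedding \<iota>"
  shows "restriction_K2 \<iota> \<in> hom (milnor_K2 TYPE('a)) (milnor_K2 TYPE('b))"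
  unfolding restriction_K2_def milnor_K2_def
  by (intro quot_map_hom comm_group.axioms(2) comm_group_symbol_group symbol_group_map_hom
      normal_milnor_subgroup symbol_group_map_relations assms)

lemma restriction_K2_symbol:
  fixes \<iota> :: "'a::field \<Rightarrow> 'b::field"
  assumes "field_embedding \<iota>" "x \<noteq> 0" "y \<noteq> 0"
  shows "restriction_K2 \<iota> (milnor_symbol x y) = milnor_symbol (\<iota> x) (\<iota> y)"
proof -
  have "frag_of (x, y) \<in> carrier (symbol_group TYPE('a))"
    using assms by (simp add: symbol_group_def)
  then show ?thesis
    unfolding restriction_K2_def milnor_symbol_def
    by (subst quot_map_coset[OF _ _ symbol_group_map_hom[OF assms(1)]])
      (auto intro!: comm_group.axioms(2) comm_group_symbol_group normal_imp_subgroup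
          normal_milnor_subgroup symbol_group_map_relations[OF assms(1), THEN subsetD]
        simp: symbol_group_map_def)
qed

lemma restriction_K2_mod2_hom:
  fixes \<iota> :: "'a::field \<Rightarrow> 'b::field"
  assumes "field_embedding \<iota>"
  shows "restriction_K2_mod2 \<iota> \<in> hom (milnor_K2_mod2 TYPE('a)) (milnor_K2_mod2 TYPE('b))"
proof -
  interpret G: comm_group "milnor_K2 TYPE('a)" by (rule comm_group_milnor_K2)
  interpret H: comm_group "milnor_K2 TYPE('b)" by (rule comm_group_milnor_K2)
  interpret h: group_hom "milnor_K2 TYPE('a)" "milnor_K2 TYPE('b)" "restriction_K2 \<iota>"
    by unfold_locales (rule restriction_K2_hom[OF assms])
  have "restriction_K2 \<iota> ` doubles (milnor_K2 TYPE('a)) \<subseteq> doubles (milnor_K2 TYPE('b))"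
    by (auto simp: doubles_def h.hom_nat_pow)
  then show ?thesis
    unfolding restriction_K2_mod2_def milnor_K2_mod2_def
    by (intro quot_map_hom normal_doubles comm_group_milnor_K2 restriction_K2_hom assms
        G.is_group H.is_group)
qed

end

theory Submission
  imports
    Defs
    "HOL-Library.Function_Algebras"
    "HOL-Library.Multiset"
    "HOL-Computational_Algebra.Polynomial_Factorial"
begin

text \<open>
  The class of the symbol \<open>{1 + a, 1 + b}\<close> survives in \<open>K\<^sub>2(L)/2\<close>.

  If \<open>{x, y}\<close> is trivial in \<open>K\<^sub>2(F)/2\<close>, then the quaternion algebra \<open>(x, y)\<close> is split, so
  \<open>p\<^sup>2 - x q\<^sup>2 - y r\<^sup>2\<close> has a nontrivial zero. This needs no Brauer group: modulo \<open>2\<close> the symbol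
  \<open>{x, y}\<close> and the symbols of finitely many relations cancel in pairs, hence there is a
  representation of the product of the corresponding \<open>n\<close> quaternion algebras on a space of dimension
  \<open>2\<^sup>n\<close> (each pair acts on a quaternion algebra from the left and from the right). A relation with
  \<open>k\<close> symbols provides \<open>k\<close> commuting involutions, whose common eigenspace is smaller by the factor
  \<open>2\<^sup>k\<close>. What remains is an action of \<open>(x, y)\<close> on a space of dimension at most \<open>2\<close>.

  Over \<open>L\<close>, the algebra \<open>(1 + a, 1 + b)\<close> is division: it contains an unramified order whose
  reduced norm form has an anisotropic reduction over the residue field of \<open>L\<close>. That residue field
  is \<open>\<kappa>\<^sup>1\<^sup>/\<^sup>2\<close>; squaring moves the reduction to the form
  \<open>P\<^sup>2 + A Q\<^sup>2 + B R\<^sup>2 + AB U\<^sup>2 + AB (PU + QR)\<close> over \<open>\<kappa>\<close>, with \<open>A = 1 + \<aa>\<close> and \<open>B = 1 + \<bb>\<close>, which is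
  anisotropic by descent on the power of \<open>B\<close> dividing a solution.
\<close>

section \<open>Split products of quaternion algebras\<close>

text \<open>For a symmetric relation, \<open>sorted_wrt\<close> relates all entries at distinct
  positions, so the order of the list is immaterial.\<close>

lemma sorted_wrt_perm:
  assumes "\<And>x y. P x y \<Longrightarrow> P y x"
  shows "mset xs = mset ys \<Longrightarrow> sorted_wrt P xs \<Longrightarrow> sorted_wrt P ys"
proof (induction ys arbitrary: xs)
  case (Cons y ys)
  then have "y \<in> set xs" by (metis list.set_intros(1) mset_eq_setD)
  then obtain as bs where xs: "xs = as @ y # bs" by (metis split_list)
  then have m: "mset (as @ bs) = mset ys" using Cons.prems by simp
  have "sorted_wrt P (as @ bs)" "\<forall>z\<in>set (as @ bs). P y z"
    using Cons.prems(2) assms by (auto simp: xs sorted_wrt_append)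
  then show ?case using Cons.IH[OF m] mset_eq_setD[OF m] by simp
qed simp

locale vector_space_not_char_2 = vector_space scale
  for scale :: "'a::field \<Rightarrow> 'b::ab_group_add \<Rightarrow> 'b" (infixr "*s" 75) +
  assumes two_neq_0: "(2::'a) \<noteq> 0"
begin

section \<open>Dimension bounds and eigenspaces of involutions\<close>

abbreviation endo :: "('b \<Rightarrow> 'b) \<Rightarrow> bool"
  where "endo T \<equiv> module_hom (*s) (*s) T"

text \<open>Dimension at most \<open>d\<close>, expressed by finite independent subsets: the
  condition makes sense for any set and passes to subsets.\<close>

definition indep_bound :: "'b set \<Rightarrow> nat \<Rightarrow> bool"
  where "indep_bound V d \<longleftrightarrow> (\<forall>B\<subseteq>V. finite B \<longrightarrow> independent B \<longrightarrow> card B \<le> d)"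

definition stable :: "('b \<Rightarrow> 'b) \<Rightarrow> 'b set \<Rightarrow> bool"
  where "stable T V \<longleftrightarrow> T ` V \<subseteq> V"

definition commute :: "('b \<Rightarrow> 'b) \<Rightarrow> ('b \<Rightarrow> 'b) \<Rightarrow> bool"
  where "commute S T \<longleftrightarrow> (\<forall>v. S (T v) = T (S v))"

lemma double_eq_0: "v + v = 0 \<longleftrightarrow> v = (0::'b)"
proof -
  have "v + v = 2 *s v" using scale_left_distrib[of 1 1 v] by simp
  then show ?thesis using two_neq_0 by simp
qed

text \<open>\<open>T\<close> sends vectors fixed by \<open>E\<close> into the eigenspace for
  \<open>-1\<close>, which meets the fixed space only in 0 because 2 is invertible. So
  \<open>B\<close> and its flip are independent together.\<close>

lemma independent_Un_flip:
  assumes E: "endo E" and T: "endo T" and inj: "\<And>v. T v = 0 \<Longrightarrow> v = 0"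
    and anti: "\<And>v. E (T v) = - T (E v)"
    and B: "finite B" "independent B" "\<And>v. v \<in> B \<Longrightarrow> E v = v"
  shows "independent (B \<union> T ` B) \<and> card (B \<union> T ` B) = 2 * card B"
proof -
  interpret E: module_hom "(*s)" "(*s)" E by fact
  interpret T: module_hom "(*s)" "(*s)" T by fact
  have inj': "inj_on T B"
    by (rule inj_onI) (metis T.diff inj right_minus_eq)
  have ET: "E (T v) = - T v" if "v \<in> B" for v using anti B(3)[OF that] by simp
  have disj: "B \<inter> T ` B = {}"
  proof (rule ccontr)
    assume "B \<inter> T ` B \<noteq> {}"
    then obtain v where v: "v \<in> B" "v \<in> T ` B" by blast
    then have "v = - v" using ET B(3) by force
    then have "v = 0" by (metis add.right_inverse double_eq_0)
    then show False using v B(2) dependent_zero by blast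
  qed
  have "independent (B \<union> T ` B)"
  proof (rule independent_if_scalars_zero)
    show "finite (B \<union> T ` B)" using B by simp
    fix f x assume 0: "(\<Sum>x\<in>B \<union> T ` B. f x *s x) = 0" and x: "x \<in> B \<union> T ` B"
    define s1 where "s1 = (\<Sum>x\<in>B. f x *s x)"
    define s2 where "s2 = (\<Sum>x\<in>B. f (T x) *s x)"
    have "(\<Sum>x\<in>T ` B. f x *s x) = T s2"
      unfolding s2_def by (simp add: sum.reindex[OF inj'] T.sum T.scale)
    then have eq: "s1 + T s2 = 0"
      using 0 sum.union_disjoint[OF B(1) finite_imageI[OF B(1)] disj, of "\<lambda>x. f x *s x"]
      by (simp add: s1_def)
    have Es1: "E s1 = s1" unfolding s1_def by (simp add: E.sum E.scale B(3))
    have Es2: "E s2 = s2" unfolding s2_def by (simp add: E.sum E.scale B(3))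
    \<comment> \<open>\<open>E\<close> fixes the first summand and negates the second; adding this
      to \<open>eq\<close> isolates \<open>s1\<close>.\<close>
    have "s1 - T s2 = E (s1 + T s2)" by (simp add: E.add anti Es1 Es2)
    then have "s1 - T s2 = 0" using eq E.zero by simp
    then have "s1 + s1 = 0" using eq by simp
    then have s1: "s1 = 0" using double_eq_0 by blast
    then have s2: "s2 = 0" using eq inj by simp
    show "f x = 0"
      using x independentD[OF B(2,1) subset_refl, of f] s1
        independentD[OF B(2,1) subset_refl, of "\<lambda>x. f (T x)"] s2
      by (auto simp: s1_def s2_def)
  qed
  then show ?thesis
    using card_Un_disjoint[OF B(1) finite_imageI[OF B(1)] disj] card_image[OF inj'] by simp
qed

text \<open>The flip \<open>T\<close> exchanges the two eigenspaces of the involution \<open>E\<close>.\<close>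

lemma eigenspace_halves:
  assumes V: "subspace V" "V \<noteq> {0}" "stable E V" "stable T V" and bound: "indep_bound V (2 * d)"
    and E: "endo E" "\<And>v. E (E v) = v" and T: "endo T" "\<And>v. T v = 0 \<Longrightarrow> v = 0"
    and anti: "\<And>v. E (T v) = - T (E v)"
  obtains V' where "V' \<subseteq> V" "subspace V'" "V' \<noteq> {0}" "indep_bound V' d"
    "\<forall>S. stable S V \<and> commute S E \<longrightarrow> stable S V'"
proof
  interpret E: module_hom "(*s)" "(*s)" E by fact
  interpret T: module_hom "(*s)" "(*s)" T by fact
  let ?V = "{v \<in> V. E v = v}"
  show "?V \<subseteq> V" by blast
  show "subspace ?V"
    using V(1) by (auto simp: subspace_def E.add E.scale E.zero)
  show "?V \<noteq> {0}"
  proof -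
    obtain v where v: "v \<in> V" "v \<noteq> 0" using V(1,2) subspace_0 by blast
    have Ev: "E v \<in> V" and Tv: "T v \<in> V" using V(3,4) v by (auto simp: stable_def)
    show ?thesis
    \<comment> \<open>Up to a factor 2, \<open>v + E v\<close> is the fixed component of
      \<open>v\<close>. If it vanishes, \<open>v\<close> lies in the eigenspace for
      \<open>-1\<close> and the flip \<open>T v\<close> is a nonzero fixed vector.\<close>
    proof (cases "v + E v = 0")
      case True
      then have "E v = - v" by (metis minus_unique)
      then have "E (T v) = T v" using anti[of v] by (simp add: T.neg)
      moreover have "T v \<noteq> 0" using T(2) v by blast
      ultimately show ?thesis using Tv by blast
    next
      case False
      moreover have "E (v + E v) = v + E v" by (simp add: E.add E(2) add.commute)
      moreover have "v + E v \<in> V" using subspace_add[OF V(1) v(1) Ev] .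
      ultimately show ?thesis by blast
    qed
  qed
  show "indep_bound ?V d"
    unfolding indep_bound_def
  proof (intro allI impI)
    fix B assume B: "B \<subseteq> ?V" "finite B" "independent B"
    have "B \<union> T ` B \<subseteq> V" using B(1) V(4) by (auto simp: stable_def)
    moreover have "E v = v" if "v \<in> B" for v using B(1) that by auto
    note flip = independent_Un_flip[OF E(1) T(1,2) anti B(2,3) this]
    ultimately have "card (B \<union> T ` B) \<le> 2 * d"
      using bound[unfolded indep_bound_def, rule_format, of "B \<union> T ` B"] flip B(2) by simp
    then show "card B \<le> d" using flip by simp
  qed
  show "\<forall>S. stable S V \<and> commute S E \<longrightarrow> stable S ?V"
    unfolding stable_def commute_def by (simp add: image_subset_iff) metis
qed

text \<open>Three halvings in succession. The conditions \<open>com\<close> make the later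
  involutions and their flips preserve the eigenspaces of the earlier involutions.\<close>

lemma eigenspace_eighth:
  assumes V: "subspace V" "V \<noteq> {0}" "stable E V" "stable T V" "stable E' V" "stable T' V"
      "stable E'' V" "stable T'' V"
    and bound: "indep_bound V (8 * d)"
    and E: "endo E" "\<And>v. E (E v) = v" "endo E'" "\<And>v. E' (E' v) = v" "endo E''" "\<And>v. E'' (E'' v) = v"
    and T: "endo T" "\<And>v. T v = 0 \<Longrightarrow> v = 0" "endo T'" "\<And>v. T' v = 0 \<Longrightarrow> v = 0"
      "endo T''" "\<And>v. T'' v = 0 \<Longrightarrow> v = 0"
    and anti: "\<And>v. E (T v) = - T (E v)" "\<And>v. E' (T' v) = - T' (E' v)" "\<And>v. E'' (T'' v) = - T'' (E'' v)"
    and com: "commute E' E" "commute T' E" "commute E'' E" "commute T'' E" "commute E'' E'" "commute T'' E'"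
  shows "\<exists>V'\<subseteq>V. subspace V' \<and> V' \<noteq> {0} \<and> indep_bound V' d \<and>
    (\<forall>S. stable S V \<and> commute S E \<and> commute S E' \<and> commute S E'' \<longrightarrow> stable S V')"
proof -
  have b: "indep_bound V (2 * (2 * (2 * d)))" using bound by simp
  from eigenspace_halves[OF V(1-4) b E(1,2) T(1,2) anti(1)]
  obtain V1 where V1: "V1 \<subseteq> V" "subspace V1" "V1 \<noteq> {0}" "indep_bound V1 (2 * (2 * d))"
    "\<forall>S. stable S V \<and> commute S E \<longrightarrow> stable S V1" .
  have s1: "stable E' V1" "stable T' V1" "stable E'' V1" "stable T'' V1"
    using V1(5) V com by simp_all
  from eigenspace_halves[OF V1(2,3) s1(1,2) V1(4) E(3,4) T(3,4) anti(2)]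
  obtain V2 where V2: "V2 \<subseteq> V1" "subspace V2" "V2 \<noteq> {0}" "indep_bound V2 (2 * d)"
    "\<forall>S. stable S V1 \<and> commute S E' \<longrightarrow> stable S V2" .
  have s2: "stable E'' V2" "stable T'' V2"
    using V2(5) s1 com by simp_all
  from eigenspace_halves[OF V2(2,3) s2 V2(4) E(5,6) T(5,6) anti(3)]
  obtain V3 where V3: "V3 \<subseteq> V2" "subspace V3" "V3 \<noteq> {0}" "indep_bound V3 d"
    "\<forall>S. stable S V2 \<and> commute S E'' \<longrightarrow> stable S V3" .
  have "V3 \<subseteq> V" using V1(1) V2(1) V3(1) by simp
  then show ?thesis using V1(5) V2(5) V3(2-5) by (intro exI[of _ V3]) simp
qed

section \<open>Lists of commuting quaternion actions\<close>

text \<open>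
  A tagged pair \<open>((x, y), (I, J))\<close> is an action of the quaternion algebra with \<open>i\<^sup>2 = x\<close>, \<open>j\<^sup>2 = y\<close>.
\<close>

definition quat_pair :: "('a \<times> 'a) \<times> (('b \<Rightarrow> 'b) \<times> ('b \<Rightarrow> 'b)) \<Rightarrow> bool"
  where "quat_pair p = (case p of ((x, y), (I, J)) \<Rightarrow> endo I \<and> endo J \<and>
    (\<forall>v. I (I v) = x *s v) \<and> (\<forall>v. J (J v) = y *s v) \<and> (\<forall>v. I (J v) = - J (I v)))"

definition ops :: "('a \<times> 'a) \<times> (('b \<Rightarrow> 'b) \<times> ('b \<Rightarrow> 'b)) \<Rightarrow> ('b \<Rightarrow> 'b) set"
  where "ops p = {fst (snd p), snd (snd p)}"

definition pairs_commute ::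
    "('a \<times> 'a) \<times> (('b \<Rightarrow> 'b) \<times> ('b \<Rightarrow> 'b)) \<Rightarrow> ('a \<times> 'a) \<times> (('b \<Rightarrow> 'b) \<times> ('b \<Rightarrow> 'b)) \<Rightarrow> bool"
  where "pairs_commute p q \<longleftrightarrow> (\<forall>S\<in>ops p. \<forall>T\<in>ops q. commute S T)"

text \<open>A representation of the tensor product of the listed quaternion algebras.\<close>

definition quat_system :: "(('a \<times> 'a) \<times> (('b \<Rightarrow> 'b) \<times> ('b \<Rightarrow> 'b))) list \<Rightarrow> bool"
  where "quat_system Z \<longleftrightarrow> (\<forall>p\<in>set Z. quat_pair p) \<and> sorted_wrt pairs_commute Z"

definition list_ops :: "(('a \<times> 'a) \<times> (('b \<Rightarrow> 'b) \<times> ('b \<Rightarrow> 'b))) list \<Rightarrow> ('b \<Rightarrow> 'b) set"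
  where "list_ops Z = \<Union> (ops ` set Z)"

text \<open>
  A sum of symbols whose product of quaternion algebras is a matrix algebra: the commutant of
  the action lives on a space smaller by the factor \<open>2\<^sup>n\<close>.
\<close>

definition reducing :: "('a \<times> 'a) list \<Rightarrow> bool"
  where "reducing L \<longleftrightarrow> (\<forall>Z V d.
    map fst Z = L \<and> quat_system Z \<and> subspace V \<and> V \<noteq> {0} \<and> (\<forall>T\<in>list_ops Z. stable T V) \<and>
    indep_bound V (2 ^ length L * d) \<longrightarrow>
    (\<exists>V'\<subseteq>V. subspace V' \<and> V' \<noteq> {0} \<and> indep_bound V' d \<and>
      (\<forall>T. endo T \<and> stable T V \<and> (\<forall>I\<in>list_ops Z. commute T I) \<longrightarrow> stable T V')))"

lemma commute_sym: "commute S T \<longleftrightarrow> commute T S"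
  by (auto simp: commute_def)

lemma reducingE:
  assumes "reducing (map fst Z)" "quat_system Z" "subspace V" "V \<noteq> {0}"
    "\<And>T. T \<in> list_ops Z \<Longrightarrow> stable T V" "indep_bound V (2 ^ length Z * d)"
  obtains V' where "V' \<subseteq> V" "subspace V'" "V' \<noteq> {0}" "indep_bound V' d"
    "\<And>T. endo T \<Longrightarrow> stable T V \<Longrightarrow> (\<And>I. I \<in> list_ops Z \<Longrightarrow> commute T I) \<Longrightarrow> stable T V'"
proof -
  have "\<exists>V'\<subseteq>V. subspace V' \<and> V' \<noteq> {0} \<and> indep_bound V' d \<and>
      (\<forall>T. endo T \<and> stable T V \<and> (\<forall>I\<in>list_ops Z. commute T I) \<longrightarrow> stable T V')"
    using assms(1)[unfolded reducing_def, rule_format, of Z V d] assms(2-) by simp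
  then show thesis using that by blast
qed

lemma reducing_Nil: "reducing []"
  unfolding reducing_def list_ops_def by auto

text \<open>Cut down by \<open>L\<close> first. The operators belonging to \<open>M\<close> commute
  with those belonging to \<open>L\<close>, hence act on the smaller space and can cut it down
  again.\<close>

lemma reducing_append:
  assumes "reducing L" "reducing M"
  shows "reducing (L @ M)"
  unfolding reducing_def
proof (intro allI impI, elim conjE)
  fix Z V d
  assume Z: "map fst Z = L @ M" "quat_system Z" and V: "subspace V" "V \<noteq> {0}"
    and st: "\<forall>T\<in>list_ops Z. stable T V" and bd: "indep_bound V (2 ^ length (L @ M) * d)"
  obtain Z1 Z2 where Z12: "Z = Z1 @ Z2" "map fst Z1 = L" "map fst Z2 = M"
    using Z(1) by (auto simp: map_eq_append_conv)
  have len: "length Z1 = length L" "length Z2 = length M" using Z12 by auto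
  have q: "quat_system Z1" "quat_system Z2"
    and c: "\<And>S T. S \<in> list_ops Z1 \<Longrightarrow> T \<in> list_ops Z2 \<Longrightarrow> commute S T"
    using Z(2) unfolding Z12(1) quat_system_def list_ops_def
    by (auto simp: sorted_wrt_append pairs_commute_def)
  have o: "list_ops Z = list_ops Z1 \<union> list_ops Z2" by (simp add: Z12(1) list_ops_def)
  obtain V1 where V1: "V1 \<subseteq> V" "subspace V1" "V1 \<noteq> {0}" "indep_bound V1 (2 ^ length Z2 * d)"
    "\<And>T. endo T \<Longrightarrow> stable T V \<Longrightarrow> (\<And>I. I \<in> list_ops Z1 \<Longrightarrow> commute T I) \<Longrightarrow> stable T V1"
    by (rule reducingE[of Z1 V "2 ^ length Z2 * d"])
      (use assms Z12 q V st o bd len in \<open>auto simp: power_add mult.assoc\<close>)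
  have "endo T" if "T \<in> list_ops Z2" for T
    using that q(2) by (auto simp: quat_system_def quat_pair_def list_ops_def ops_def)
  then have "\<And>T. T \<in> list_ops Z2 \<Longrightarrow> stable T V1"
    using V1(5) st o c commute_sym by blast
  then obtain V2 where V2: "V2 \<subseteq> V1" "subspace V2" "V2 \<noteq> {0}" "indep_bound V2 d"
    "\<And>T. endo T \<Longrightarrow> stable T V1 \<Longrightarrow> (\<And>I. I \<in> list_ops Z2 \<Longrightarrow> commute T I) \<Longrightarrow> stable T V2"
    using reducingE[of Z2 V1 d] assms(2) Z12(3) q(2) V1(2-4) by metis
  show "\<exists>V'\<subseteq>V. subspace V' \<and> V' \<noteq> {0} \<and> indep_bound V' d \<and>
      (\<forall>T. endo T \<and> stable T V \<and> (\<forall>I\<in>list_ops Z. commute T I) \<longrightarrow> stable T V')"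
    by (rule exI[of _ V2]) (use V1 V2 o in auto)
qed

lemma quat_pair_swap: "quat_pair p \<Longrightarrow> quat_pair (map_prod prod.swap prod.swap p)"
  by (cases p) (simp add: quat_pair_def split: prod.splits)

text \<open>Exchanging the two generators in every pair leaves the set of operators unchanged. This
  transfers bilinearity in the first entry to the second.\<close>

lemma reducing_swap:
  assumes "reducing L"
  shows "reducing (map prod.swap L)"
  unfolding reducing_def
proof (intro allI impI, elim conjE)
  fix Z V d
  assume Z: "map fst Z = map prod.swap L" "quat_system Z" and V: "subspace V" "V \<noteq> {0}"
    and st: "\<forall>T\<in>list_ops Z. stable T V" and bd: "indep_bound V (2 ^ length (map prod.swap L) * d)"
  define Z' where "Z' = map (map_prod prod.swap prod.swap) Z"
  have len: "length Z' = length L" using Z(1) map_eq_imp_length_eq unfolding Z'_def by fastforce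
  have "map fst Z' = map prod.swap (map fst Z)" by (simp add: Z'_def)
  then have 1: "map fst Z' = L" by (simp add: Z(1) comp_def)
  have o: "ops (map_prod prod.swap prod.swap p) = ops p" for p
    by (cases p) (auto simp: ops_def)
  have c: "pairs_commute (map_prod prod.swap prod.swap p) (map_prod prod.swap prod.swap q) =
      pairs_commute p q" for p q
    by (simp add: pairs_commute_def o)
  have 2: "quat_system Z'"
    using Z(2) unfolding quat_system_def Z'_def
    by (auto simp only: sorted_wrt_map c set_map ball_simps intro!: quat_pair_swap)
  have 3: "list_ops Z' = list_ops Z"
    by (simp add: list_ops_def Z'_def o image_image)
  obtain V' where "V' \<subseteq> V" "subspace V'" "V' \<noteq> {0}" "indep_bound V' d"
    "\<And>T. endo T \<Longrightarrow> stable T V \<Longrightarrow> (\<And>I. I \<in> list_ops Z \<Longrightarrow> commute T I) \<Longrightarrow> stable T V'"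
    using reducingE[of Z' V d] 1 2 3 len assms V st bd by auto
  then show "\<exists>V'\<subseteq>V. subspace V' \<and> V' \<noteq> {0} \<and> indep_bound V' d \<and>
      (\<forall>T. endo T \<and> stable T V \<and> (\<forall>I\<in>list_ops Z. commute T I) \<longrightarrow> stable T V')" by auto
qed

section \<open>The relations of Milnor K-theory give reducing lists\<close>

lemma endo_comp: "endo S \<Longrightarrow> endo T \<Longrightarrow> endo (\<lambda>v. S (T v))"
  using module_hom_compose[of "(*s)" "(*s)" T "(*s)" S] by (simp add: comp_def)

lemma endo_scaled: "endo S \<Longrightarrow> endo (\<lambda>v. c *s S v)"
  by (auto simp: module_hom_iff scale_right_distrib scale_left_commute)

lemma stable_comp: "stable S V \<Longrightarrow> stable T V \<Longrightarrow> stable (\<lambda>v. S (T v)) V"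
  by (auto simp: stable_def)

lemma stable_scaled: "subspace V \<Longrightarrow> stable S V \<Longrightarrow> stable (\<lambda>v. c *s S v) V"
  by (auto simp: stable_def subspace_scale)

lemma inj_of_square: "endo T \<Longrightarrow> (\<And>v. T (T v) = c *s v) \<Longrightarrow> c \<noteq> 0 \<Longrightarrow> T v = 0 \<Longrightarrow> v = 0"
  by (metis module_hom.zero scale_eq_0_iff)

text \<open>
  The involutions are \<open>X\<^sub>1X\<^sub>2X\<^sub>3\<close>, \<open>Z\<^sub>1Z\<^sub>2\<close> and \<open>Z\<^sub>2Z\<^sub>3\<close>, suitably scaled; they commute and are flipped
  separately by \<open>Z\<^sub>1\<close>, \<open>X\<^sub>1\<close> and \<open>X\<^sub>3\<close>.
\<close>

lemma reducing_mult:
  assumes nz: "x \<noteq> 0" "y \<noteq> 0" "z \<noteq> 0"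
  shows "reducing [(x * y, z), (x, z), (y, z)]"
  unfolding reducing_def
proof (intro allI impI, elim conjE)
  fix Z V d
  assume Z: "map fst Z = [(x * y, z), (x, z), (y, z)]" "quat_system Z"
    and V: "subspace V" "V \<noteq> {0}"
    and st: "\<forall>T\<in>list_ops Z. stable T V"
    and bd: "indep_bound V (2 ^ length [(x * y, z), (x, z), (y, z)] * d)"
  obtain X1 Z1 X2 Z2 X3 Z3 where Zeq:
    "Z = [((x * y, z), (X1, Z1)), ((x, z), (X2, Z2)), ((y, z), (X3, Z3))]"
    using Z(1) by (auto simp: map_eq_Cons_conv)
  have e: "endo X1" "endo X2" "endo X3" "endo Z1" "endo Z2" "endo Z3"
    using Z(2) unfolding Zeq quat_system_def quat_pair_def by auto
  have sq: "X1 (X1 v) = (x * y) *s v" "X2 (X2 v) = x *s v" "X3 (X3 v) = y *s v"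
    "Z1 (Z1 v) = z *s v" "Z2 (Z2 v) = z *s v" "Z3 (Z3 v) = z *s v"
    "Z1 (X1 v) = - X1 (Z1 v)" "Z2 (X2 v) = - X2 (Z2 v)" "Z3 (X3 v) = - X3 (Z3 v)" for v
    using Z(2) unfolding Zeq quat_system_def quat_pair_def by auto
  have com: "X2 (X1 v) = X1 (X2 v)" "X3 (X1 v) = X1 (X3 v)" "X3 (X2 v) = X2 (X3 v)"
    "Z2 (Z1 v) = Z1 (Z2 v)" "Z3 (Z1 v) = Z1 (Z3 v)" "Z3 (Z2 v) = Z2 (Z3 v)"
    "Z1 (X2 v) = X2 (Z1 v)" "Z1 (X3 v) = X3 (Z1 v)" "Z2 (X1 v) = X1 (Z2 v)"
    "Z2 (X3 v) = X3 (Z2 v)" "Z3 (X1 v) = X1 (Z3 v)" "Z3 (X2 v) = X2 (Z3 v)" for v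
    using Z(2) unfolding Zeq quat_system_def pairs_commute_def ops_def commute_def by auto
  note lin = e[THEN module_hom.scale] e[THEN module_hom.neg]
  have o: "list_ops Z = {X1, Z1, X2, Z2, X3, Z3}" by (auto simp: list_ops_def ops_def Zeq)
  have st': "stable X1 V" "stable X2 V" "stable X3 V" "stable Z1 V" "stable Z2 V" "stable Z3 V"
    using st o by auto
  \<comment> \<open>The unscaled products square to \<open>(x * y)\<^sup>2\<close>,
    \<open>z\<^sup>2\<close> and \<open>z\<^sup>2\<close>, which determines the scalars.\<close>
  let ?P = "\<lambda>v. inverse (x * y) *s X1 (X2 (X3 v))"
  let ?R = "\<lambda>v. inverse z *s Z1 (Z2 v)"
  let ?Q = "\<lambda>v. inverse z *s Z2 (Z3 v)"
  have eP: "endo ?P" and eR: "endo ?R" and eQ: "endo ?Q"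
    using endo_scaled[OF endo_comp[OF e(1) endo_comp[OF e(2,3)]]]
      endo_scaled[OF endo_comp[OF e(4,5)]] endo_scaled[OF endo_comp[OF e(5,6)]] by auto
  have sP: "stable ?P V" and sR: "stable ?R V" and sQ: "stable ?Q V"
    using stable_scaled[OF V(1) stable_comp[OF st'(1) stable_comp[OF st'(2,3)]]]
      stable_scaled[OF V(1) stable_comp[OF st'(4,5)]]
      stable_scaled[OF V(1) stable_comp[OF st'(5,6)]] by auto
  have "\<exists>V'\<subseteq>V. subspace V' \<and> V' \<noteq> {0} \<and> indep_bound V' d \<and>
      (\<forall>S. stable S V \<and> commute S ?P \<and> commute S ?R \<and> commute S ?Q \<longrightarrow> stable S V')"
  \<comment> \<open>The order is chosen so that each flip preserves the eigenspaces cut out before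
    it: \<open>X1\<close> and \<open>X3\<close> commute with \<open>?P\<close>, and
    \<open>X3\<close> commutes with \<open>?R\<close>.\<close>
  proof (rule eigenspace_eighth[of V ?P Z1 ?R X1 ?Q X3 d])
    show "indep_bound V (8 * d)" using bd by simp
    have "inverse x * inverse y * (inverse x * inverse y * y * x * (x * y)) = 1"
      using nz by (simp add: field_simps)
    then show "?P (?P v) = v" for v by (simp add: lin com sq)
    show "Z1 v = 0 \<Longrightarrow> v = 0" "X1 v = 0 \<Longrightarrow> v = 0" "X3 v = 0 \<Longrightarrow> v = 0" for v
      using inj_of_square[OF e(4) sq(4), of v] inj_of_square[OF e(1) sq(1), of v]
        inj_of_square[OF e(3) sq(3), of v] nz by simp_all
  qed (use V st' sP sR sQ e eP eR eQ nz in
      \<open>simp_all add: commute_def lin com sq scale_left_commute\<close>)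
  moreover have "commute T ?P \<and> commute T ?R \<and> commute T ?Q"
    if "endo T" "\<forall>I\<in>list_ops Z. commute T I" for T
    using that module_hom.scale[OF that(1)] by (simp add: o commute_def)
  ultimately show "\<exists>V'\<subseteq>V. subspace V' \<and> V' \<noteq> {0} \<and> indep_bound V' d \<and>
      (\<forall>T. endo T \<and> stable T V \<and> (\<forall>I\<in>list_ops Z. commute T I) \<longrightarrow> stable T V')"
    by (elim exE conjE, intro exI conjI) (assumption+, simp)
qed

text \<open>\<open>I + J\<close> is an involution, because \<open>I\<close> and \<open>J\<close>
  anticommute and their squares \<open>x\<close> and \<open>1 - x\<close> add up to 1. The product
  \<open>I J\<close> anticommutes with both generators and is the flip.\<close>

lemma reducing_steinberg:
  assumes nz: "x \<noteq> 0" "x \<noteq> 1"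
  shows "reducing [(x, 1 - x)]"
  unfolding reducing_def
proof (intro allI impI, elim conjE)
  fix Z V d
  assume Z: "map fst Z = [(x, 1 - x)]" "quat_system Z" and V: "subspace V" "V \<noteq> {0}"
    and st: "\<forall>T\<in>list_ops Z. stable T V"
    and bd: "indep_bound V (2 ^ length [(x, 1 - x)] * d)"
  obtain I J where Zeq: "Z = [((x, 1 - x), (I, J))]"
    using Z(1) by (auto simp: map_eq_Cons_conv)
  have e: "endo I" "endo J"
    and sq: "I (I v) = x *s v" "J (J v) = (1 - x) *s v" "J (I v) = - I (J v)" for v
    using Z(2) unfolding Zeq quat_system_def quat_pair_def by auto
  note lin = e[THEN module_hom.scale] e[THEN module_hom.neg] e[THEN module_hom.add]
    e[THEN module_hom.diff]
  have o: "list_ops Z = {I, J}" by (auto simp: list_ops_def ops_def Zeq)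
  have st': "stable I V" "stable J V" using st o by auto
  let ?E = "\<lambda>v. I v + J v"
  let ?T = "\<lambda>v. I (J v)"
  obtain V' where V': "V' \<subseteq> V" "subspace V'" "V' \<noteq> {0}" "indep_bound V' d"
    "\<forall>S. stable S V \<and> commute S ?E \<longrightarrow> stable S V'"
  proof (rule eigenspace_halves[of V ?E ?T d])
    show "stable ?E V" using st' by (auto simp: stable_def image_subset_iff intro: subspace_add[OF V(1)])
    show "stable ?T V" using st' by (auto simp: stable_def)
    show "endo ?E" using e by (auto simp: module_hom_iff scale_right_distrib)
    show "endo ?T" using e by (rule endo_comp)
    show "indep_bound V (2 * d)" using bd by simp
    show "?E (?E v) = v" for v
    proof -
      have "?E (?E v) = x *s v + (1 - x) *s v" by (simp add: lin sq)
      then show ?thesis using scale_left_distrib[of x "1 - x" v] by (simp only:) simp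
    qed
    show "?T v = 0 \<Longrightarrow> v = 0" for v
      using inj_of_square[OF e(1) sq(1), of "J v"] inj_of_square[OF e(2) sq(2), of v] nz by simp
    show "?E (?T v) = - ?T (?E v)" for v
      by (simp add: lin sq)
  qed (use V in auto)
  then show "\<exists>V'\<subseteq>V. subspace V' \<and> V' \<noteq> {0} \<and> indep_bound V' d \<and>
      (\<forall>T. endo T \<and> stable T V \<and> (\<forall>I\<in>list_ops Z. commute T I) \<longrightarrow> stable T V')"
    by (intro exI[of _ V']) (auto simp: o commute_def module_hom.add)
qed

text \<open>In a space of dimension at most \<open>2\<close>, the vectors \<open>v\<close>, \<open>iv\<close>, \<open>jv\<close> are linearly dependent.\<close>

lemma norm_isotropic:
  assumes q: "quat_pair ((x, y), (I, J))" and V: "V \<noteq> {0}" "subspace V"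
    and st: "stable I V" "stable J V" and bd: "indep_bound V 2"
  shows "\<exists>p q r. (p \<noteq> 0 \<or> q \<noteq> 0 \<or> r \<noteq> 0) \<and> p\<^sup>2 - x * q\<^sup>2 - y * r\<^sup>2 = 0"
proof -
  have e: "endo I" "endo J"
    and sq: "I (I v) = x *s v" "J (J v) = y *s v" "J (I v) = - I (J v)" for v
    using q by (auto simp: quat_pair_def)
  note lin = e[THEN module_hom.scale] e[THEN module_hom.neg] e[THEN module_hom.add]
    e[THEN module_hom.zero] e[THEN module_hom.diff]
  obtain v where v: "v \<in> V" "v \<noteq> 0" using V subspace_0 by blast
  have "\<exists>p q r. (p \<noteq> 0 \<or> q \<noteq> 0 \<or> r \<noteq> 0) \<and> p *s v + q *s I v + r *s J v = 0"
  proof (rule ccontr)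
    assume "\<not> ?thesis"
    then have ind: "p = 0 \<and> q = 0 \<and> r = 0" if "p *s v + q *s I v + r *s J v = 0" for p q r
      using that by blast
    have d: "v \<noteq> I v" "v \<noteq> J v" "I v \<noteq> J v"
      using ind[of 1 "-1" 0] ind[of 1 0 "-1"] ind[of 0 1 "-1"] by auto
    have "independent {v, I v, J v}"
    proof (rule independent_if_scalars_zero)
      fix f z assume "(\<Sum>z\<in>{v, I v, J v}. f z *s z) = 0" "z \<in> {v, I v, J v}"
      then show "f z = 0" using ind[of "f v" "f (I v)" "f (J v)"] d by (auto simp: add.assoc)
    qed simp
    moreover have "{v, I v, J v} \<subseteq> V" using v st by (auto simp: stable_def)
    ultimately have "card {v, I v, J v} \<le> 2" using bd by (simp add: indep_bound_def)
    then show False using d by simp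
  qed
  then obtain p q r where n: "p \<noteq> 0 \<or> q \<noteq> 0 \<or> r \<noteq> 0" and 0: "p *s v + q *s I v + r *s J v = 0"
    by blast
  let ?w = "p *s v + q *s I v + r *s J v"
  \<comment> \<open>Apply the conjugate \<open>p - q I - r J\<close> to the relation; the mixed
    terms cancel by anticommutation.\<close>
  have "(p\<^sup>2 - x * q\<^sup>2 - y * r\<^sup>2) *s v = p *s ?w - q *s I ?w - r *s J ?w"
    by (simp add: lin sq scale_right_distrib scale_right_diff_distrib scale_left_diff_distrib power2_eq_square mult_ac)
  also have "\<dots> = 0" by (simp only: 0 lin scale_zero_right) simp
  finally show ?thesis using v n by auto
qed

text \<open>Used to pass from a list where equal symbols are adjacent to one that starts with the
  given symbol and continues with the relations.\<close>

lemma quat_system_perm: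
  assumes "quat_system Z" "mset L = mset (map fst Z)"
  obtains Z' where "quat_system Z'" "map fst Z' = L" "list_ops Z' = list_ops Z"
proof -
  obtain Z' where Z': "mset Z' = mset Z" "list_all2 (\<lambda>l z. l = fst z) L Z'"
    using list_all2_reorder_left_invariance[of "\<lambda>l z. l = fst z" "map fst Z" Z L] assms(2)
    by (auto simp: list_all2_map1 list_all2_refl)
  from Z'(2) have "map fst Z' = L"
    by (auto simp: list_all2_conv_all_nth intro: nth_equalityI)
  moreover have "pairs_commute p q \<Longrightarrow> pairs_commute q p" for p q
    using commute_sym by (auto simp: pairs_commute_def)
  then have "sorted_wrt pairs_commute Z'"
    using sorted_wrt_perm[of pairs_commute Z Z'] Z'(1) assms(1) by (simp add: quat_system_def)
  ultimately show thesis
    using assms(1) that[of Z'] mset_eq_setD[OF Z'(1)]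
    by (simp add: quat_system_def list_ops_def)
qed

end

section \<open>Trivial symbols and isotropic norm forms\<close>

definition fun_scale :: "'a::field \<Rightarrow> ('w \<Rightarrow> 'a) \<Rightarrow> 'w \<Rightarrow> 'a"
  where "fun_scale c f = (\<lambda>w. c * f w)"

lemma vector_space_fun_scale: "vector_space fun_scale"
  by unfold_locales (auto simp: fun_scale_def fun_eq_iff algebra_simps)

lemma vector_space_not_char_2_fun_scale:
  "(2::'a::field) \<noteq> 0 \<Longrightarrow> vector_space_not_char_2 (fun_scale :: 'a \<Rightarrow> ('w \<Rightarrow> 'a) \<Rightarrow> _)"
  by (simp add: vector_space_not_char_2_def vector_space_not_char_2_axioms_def
      vector_space_fun_scale)

section \<open>Quaternion operators on functions of subsets\<close>

definition toggle :: "nat \<Rightarrow> nat set \<Rightarrow> nat set"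
  where "toggle k w = (if k \<in> w then w - {k} else insert k w)"

text \<open>Subsets index a basis of a tensor power of the plane, with one factor for each
  \<open>k\<close>. In factor \<open>k\<close> this is the matrix with off-diagonal entries
  \<open>1\<close> and \<open>c\<close>, a square root of \<open>c\<close>; \<open>sign_op\<close>
  is the diagonal matrix with entries \<open>1\<close> and \<open>-1\<close>, which anticommutes
  with it.\<close>

definition shift_op :: "'a::field \<Rightarrow> nat \<Rightarrow> (nat set \<Rightarrow> 'a) \<Rightarrow> nat set \<Rightarrow> 'a"
  where "shift_op c k f = (\<lambda>w. (if k \<in> w then 1 else c) * f (toggle k w))"

definition sign_op :: "nat \<Rightarrow> (nat set \<Rightarrow> 'a::field) \<Rightarrow> nat set \<Rightarrow> 'a"
  where "sign_op k f = (\<lambda>w. if k \<in> w then - f w else f w)"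

lemma toggle_simps: "toggle k (toggle k w) = w" "k \<in> toggle k w \<longleftrightarrow> k \<notin> w"
  "k \<noteq> l \<Longrightarrow> k \<in> toggle l w \<longleftrightarrow> k \<in> w" "toggle k (toggle l w) = toggle l (toggle k w)"
  by (auto simp: toggle_def)

lemma shift_shift: "shift_op c k (shift_op c k f) = fun_scale c f"
  by (auto simp: shift_op_def fun_scale_def toggle_simps fun_eq_iff)

lemma sign_sign: "sign_op k (sign_op k f) = f"
  by (auto simp: sign_op_def fun_eq_iff)

lemma sign_shift: "sign_op k (shift_op c k f) = - shift_op c k (sign_op k f)"
  by (auto simp: shift_op_def sign_op_def toggle_simps fun_eq_iff)

lemma ops_commute:
  assumes "k \<noteq> l"
  shows "shift_op c k (shift_op d l f) = shift_op d l (shift_op c k f)"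
    "sign_op k (shift_op d l f) = shift_op d l (sign_op k f)"
    "sign_op k (sign_op l f) = sign_op l (sign_op k f)"
    "shift_op c k (sign_op l f) = sign_op l (shift_op c k f)"
  using assms
  by (auto simp: shift_op_def sign_op_def toggle_simps(2,3) fun_eq_iff toggle_simps(4)[of k l])

lemma op_minus: "shift_op c k (- f) = - shift_op c k f" "sign_op k (- f) = - sign_op k f"
  and op_scale: "shift_op c k (fun_scale d f) = fun_scale d (shift_op c k f)"
    "sign_op k (fun_scale d f) = fun_scale d (sign_op k f)"
  by (auto simp: shift_op_def sign_op_def fun_scale_def fun_eq_iff)

lemma sum_apply: "(\<Sum>i\<in>S. f i) w = (\<Sum>i\<in>S. (f i w :: 'a::comm_monoid_add))"
  by (induction S rule: infinite_finite_induct) auto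

text \<open>The quaternion algebra acting on itself from the left and from the right.\<close>

definition regular_pairs ::
    "'a::field \<times> 'a \<Rightarrow> nat \<Rightarrow>
      (('a \<times> 'a) \<times> (((nat set \<Rightarrow> 'a) \<Rightarrow> _) \<times> ((nat set \<Rightarrow> 'a) \<Rightarrow> _))) list"
  where "regular_pairs p n =
    [(p, (shift_op (fst p) (2 * n), \<lambda>f. sign_op (2 * n) (shift_op (snd p) (2 * n + 1) f))),
     (p, (\<lambda>f. sign_op (2 * n + 1) (shift_op (fst p) (2 * n) f), shift_op (snd p) (2 * n + 1)))]"

fun doubled :: "('a \<times> 'a) list \<Rightarrow> ('a \<times> 'a) list"
  where "doubled [] = []"
  | "doubled (p # D) = p # p # doubled D"

text \<open>The counter gives every quaternion algebra its own positions \<open>2 * n\<close> and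
  \<open>2 * n + 1\<close>, so that actions on different ones commute.\<close>

fun doubled_system ::
    "('a::field \<times> 'a) list \<Rightarrow> nat \<Rightarrow>
      (('a \<times> 'a) \<times> (((nat set \<Rightarrow> 'a) \<Rightarrow> _) \<times> ((nat set \<Rightarrow> 'a) \<Rightarrow> _))) list"
  where "doubled_system [] n = []"
  | "doubled_system (p # D) n = regular_pairs p n @ doubled_system D (Suc n)"

lemma map_fst_doubled_system: "map fst (doubled_system D n) = doubled D"
  by (induction D arbitrary: n) (auto simp: regular_pairs_def)

lemma length_doubled: "length (doubled D) = 2 * length D"
  by (induction D) auto

lemma doubled_system_memD:
  "q \<in> set (doubled_system D n) \<Longrightarrow>
    \<exists>m p. n \<le> m \<and> m < n + length D \<and> q \<in> set (regular_pairs p m)"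
proof (induction D arbitrary: n)
  case (Cons a D)
  from Cons.prems consider "q \<in> set (regular_pairs a n)" | "q \<in> set (doubled_system D (Suc n))"
    by auto
  then show ?case
  proof cases
    case 1
    then show ?thesis by (intro exI[of _ n] exI[of _ a]) simp
  next
    case 2
    then obtain m p where "Suc n \<le> m" "m < Suc n + length D" "q \<in> set (regular_pairs p m)"
      using Cons.IH by blast
    then show ?thesis by (intro exI[of _ m] exI[of _ p]) simp
  qed
qed simp

lemma even_count_imp_doubled:
  "\<forall>p. even (count M p) \<Longrightarrow> \<exists>D. mset (doubled D) = M"
proof (induction "size M" arbitrary: M rule: less_induct)
  case less
  show ?case
  proof (cases "M = {#}")
    case True
    then show ?thesis by (intro exI[of _ "[]"]) simp
  next
    case False
    then obtain p where p: "p \<in># M" by blast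
    then have "count M p > 0" "even (count M p)" using spec[OF less.prems, of p] by simp_all
    then have "count M p \<ge> 2" by presburger
    then have "{#p, p#} \<subseteq># M" by (auto simp: subseteq_mset_def)
    then obtain M' where M: "M = {#p, p#} + M'" by (metis subset_mset.le_iff_add)
    have "\<forall>q. even (count M' q)"
    proof
      fix q show "even (count M' q)"
        using less.prems[rule_format, of q] by (auto simp: M split: if_splits)
    qed
    then obtain D where "mset (doubled D) = M'" using less.hyps[of M'] by (auto simp: M)
    then show ?thesis by (intro exI[of _ "p # D"]) (simp add: M)
  qed
qed

text \<open>The part of the function space that uses only the first \<open>N\<close> tensor factors.
  One type thus carries the representations for lists of every length.\<close>

definition supported_on :: "nat \<Rightarrow> (nat set \<Rightarrow> 'a::zero) set"
  where "supported_on N = {f. \<forall>w. f w \<noteq> 0 \<longrightarrow> w \<subseteq> {..<N}}"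

context
  assumes two_neq_0: "(2::'a::field) \<noteq> 0"
begin

interpretation V: vector_space_not_char_2 "fun_scale :: 'a \<Rightarrow> (nat set \<Rightarrow> 'a) \<Rightarrow> _"
  by (rule vector_space_not_char_2_fun_scale[OF two_neq_0])

lemma endo_ops: "V.endo (shift_op (c::'a) k)" "V.endo (sign_op k)"
  by (auto simp: module_hom_iff V.module_axioms shift_op_def sign_op_def fun_scale_def fun_eq_iff algebra_simps)

lemma stable_ops:
  assumes "k < N"
  shows "V.stable (shift_op c k) (supported_on N)" "V.stable (sign_op k) (supported_on N)"
proof -
  have "toggle k w \<subseteq> {..<N} \<longleftrightarrow> w \<subseteq> {..<N}" for w
    using assms by (auto simp: toggle_def)
  note t = this
  show "V.stable (shift_op c k) (supported_on N)"
    unfolding V.stable_def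
  proof (rule image_subsetI)
    fix f :: "nat set \<Rightarrow> 'a" assume f: "f \<in> supported_on N"
    have "w \<subseteq> {..<N}" if "shift_op c k f w \<noteq> 0" for w
    proof -
      have "f (toggle k w) \<noteq> 0" using that by (auto simp: shift_op_def)
      then have "toggle k w \<subseteq> {..<N}" using f by (simp add: supported_on_def)
      then show ?thesis by (simp add: t)
    qed
    then show "shift_op c k f \<in> supported_on N" by (simp add: supported_on_def)
  qed
  show "V.stable (sign_op k) (supported_on N)"
    by (auto simp: V.stable_def supported_on_def sign_op_def split: if_splits)
qed

lemma supported_on: "V.subspace (supported_on N)" "supported_on N \<noteq> {0::nat set \<Rightarrow> 'a}"
  "V.indep_bound (supported_on N) (2 ^ N)"
proof -
  have "f w \<noteq> 0 \<or> g w \<noteq> 0" if "(f + g) w \<noteq> 0" for f g :: "nat set \<Rightarrow> 'a" and w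
    using that by (cases "f w = 0") auto
  then show "V.subspace (supported_on N)"
    unfolding supported_on_def by (intro V.subspaceI) (auto simp: fun_scale_def, blast)
  have "(\<lambda>w. if w = {} then 1 else 0 :: 'a) \<in> supported_on N"
    by (auto simp: supported_on_def)
  moreover have "(\<lambda>w. if w = {} then 1 else 0 :: 'a) \<noteq> (0 :: nat set \<Rightarrow> 'a)"
    by (auto simp: fun_eq_iff)
  ultimately show "supported_on N \<noteq> {0::nat set \<Rightarrow> 'a}" by blast
  let ?d = "\<lambda>u w. if w = u then 1 else 0 :: 'a"
  have "f \<in> V.span (?d ` Pow {..<N})" if f: "f \<in> supported_on N" for f
  proof -
    have "(\<Sum>u\<in>Pow {..<N}. fun_scale (f u) (?d u)) \<in> V.span (?d ` Pow {..<N})"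
      by (intro V.span_sum V.span_scale V.span_base) auto
    moreover have "(\<Sum>u\<in>Pow {..<N}. fun_scale (f u) (?d u)) w = f w" for w
    proof -
      have "(\<Sum>u\<in>Pow {..<N}. fun_scale (f u) (?d u)) w = (\<Sum>u\<in>Pow {..<N}. f u * ?d u w)"
        by (simp add: sum_apply fun_scale_def)
      also have "\<dots> = (if w \<in> Pow {..<N} then f w else 0)"
        by (simp add: sum.delta if_distrib cong: if_cong)
      finally show ?thesis using f by (auto simp: supported_on_def)
    qed
    then have "(\<Sum>u\<in>Pow {..<N}. fun_scale (f u) (?d u)) = f" by (rule ext)
    ultimately show ?thesis by (simp only:)
  qed
  then have "supported_on N \<subseteq> V.span (?d ` Pow {..<N})" by blast
  moreover have "card (?d ` Pow {..<N}) \<le> 2 ^ N"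
    using card_image_le[of "Pow {..<N}" ?d] by (simp add: card_Pow)
  ultimately show "V.indep_bound (supported_on N) (2 ^ N)"
    unfolding V.indep_bound_def
    using V.independent_span_bound[of "?d ` Pow {..<N}"] by (meson dual_order.trans finite_Pow_iff
      finite_imageI finite_lessThan subset_trans)
qed

lemma quat_system_doubled: "V.quat_system (doubled_system D n)"
proof (induction D arbitrary: n)
  case Nil
  show ?case by (simp add: V.quat_system_def)
next
  case (Cons p D)
  have c: "V.pairs_commute q r" if qr: "q \<in> set (regular_pairs p n)" "r \<in> set (doubled_system D (Suc n))"
    for q r
  proof -
    obtain m p' where m: "Suc n \<le> m" "r \<in> set (regular_pairs p' m)"
      using doubled_system_memD[OF qr(2)] by blast
    have "2 * m \<noteq> 2 * n" "2 * m \<noteq> 2 * n + 1" "2 * m + 1 \<noteq> 2 * n" "2 * m + 1 \<noteq> 2 * n + 1"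
      using m(1) by presburger+
    note nn = this[THEN ops_commute(1)] this[THEN ops_commute(2)] this[THEN ops_commute(3)]
      this[THEN ops_commute(4)]
    show ?thesis
      using qr(1) m(2) unfolding regular_pairs_def
      by (auto simp del: One_nat_def add_Suc_right simp: V.pairs_commute_def V.ops_def V.commute_def nn)
  qed
  have "2 * n + 1 \<noteq> 2 * n" by simp
  note nn = ops_commute[OF this]
  \<comment> \<open>The case with signs is the second generator of the left action against the first
    of the right action: each of the two positions contributes a sign, and they cancel.\<close>
  have 1: "V.pairs_commute (regular_pairs p n ! 0) (regular_pairs p n ! 1)"
    unfolding regular_pairs_def
    by (auto simp del: One_nat_def add_Suc_right simp: V.pairs_commute_def V.ops_def V.commute_def
        nn sign_shift op_minus)
  have 2: "V.quat_pair q" if "q \<in> set (regular_pairs p n)" for q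
    using that unfolding regular_pairs_def
    by (auto simp del: One_nat_def add_Suc_right simp: V.quat_pair_def nn shift_shift sign_sign
        sign_shift op_minus op_scale split_beta endo_ops V.endo_comp)
  show ?case
    using Cons[of "Suc n"] c 1 2
    by (auto simp: V.quat_system_def sorted_wrt_append regular_pairs_def)
qed

lemma stable_doubled_system:
  assumes "T \<in> V.list_ops (doubled_system D 0)"
  shows "V.stable T (supported_on (2 * length D))"
proof -
  obtain q where q: "q \<in> set (doubled_system D 0)" "T \<in> V.ops q"
    using assms by (auto simp: V.list_ops_def)
  obtain m p where m: "m < length D" "q \<in> set (regular_pairs p m)"
    using doubled_system_memD[OF q(1)] by auto
  have "2 * m < 2 * length D" "2 * m + 1 < 2 * length D" using m(1) by auto
  note s = this[THEN stable_ops(1)] this[THEN stable_ops(2)]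
  show ?thesis
    using q(2) m(2) unfolding regular_pairs_def
    by (auto simp del: One_nat_def add_Suc_right simp: V.ops_def s intro!: V.stable_comp[OF s(3) s(2)]
        V.stable_comp[OF s(4) s(1)])
qed

text \<open>If \<open>L\<close> has length \<open>n\<close>, the \<open>n + 1\<close> symbols pair
  up and act on a space of dimension \<open>2 ^ (n + 1)\<close>. Cutting down by \<open>L\<close>
  leaves dimension at most 2 with \<open>(x, y)\<close> still acting, and
  \<open>norm_isotropic\<close> applies.\<close>

lemma reducing_even_isotropic:
  assumes red: "V.reducing L" and ev: "\<And>p. even (count (mset ((x, y) # L)) p)"
  shows "\<exists>p q r. (p \<noteq> 0 \<or> q \<noteq> 0 \<or> r \<noteq> 0) \<and> p\<^sup>2 - x * q\<^sup>2 - y * r\<^sup>2 = (0::'a)"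
proof -
  obtain D where D: "mset (doubled D) = mset ((x, y) # L)"
    using even_count_imp_doubled ev by blast
  let ?N = "2 * length D"
  let ?V = "supported_on ?N :: (nat set \<Rightarrow> 'a) set"
  have len: "?N = Suc (length L)"
    using arg_cong[OF D, of size] by (simp add: length_doubled)
  obtain Z where Z: "V.quat_system Z" "map fst Z = (x, y) # L"
    "V.list_ops Z = V.list_ops (doubled_system D 0)"
    using V.quat_system_perm[OF quat_system_doubled[of D 0], of "(x, y) # L"] D
    by (metis map_fst_doubled_system)
  obtain I J Z' where ZZ: "Z = ((x, y), (I, J)) # Z'" "map fst Z' = L"
    using Z(2) by (auto simp: map_eq_Cons_conv)
  have q: "V.quat_pair ((x, y), (I, J))" "V.quat_system Z'"
    and com: "\<And>T. T \<in> V.list_ops Z' \<Longrightarrow> V.commute I T \<and> V.commute J T"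
    using Z(1) by (auto simp: V.quat_system_def ZZ V.pairs_commute_def V.ops_def V.list_ops_def)
  have st: "V.stable T ?V" if "T \<in> V.list_ops Z" for T
    using stable_doubled_system that Z(3) by simp
  have IJ: "I \<in> V.list_ops Z" "J \<in> V.list_ops Z" "V.list_ops Z' \<subseteq> V.list_ops Z"
    by (auto simp: ZZ V.list_ops_def V.ops_def)
  have lenZ: "length Z' = length L" using ZZ(2) by auto
  obtain V' where V': "V.subspace V'" "V' \<noteq> {0}" "V.indep_bound V' 2"
    "\<And>T. V.endo T \<Longrightarrow> V.stable T ?V \<Longrightarrow> (\<And>I. I \<in> V.list_ops Z' \<Longrightarrow> V.commute T I) \<Longrightarrow> V.stable T V'"
  proof (rule V.reducingE[of Z' ?V 2])
    show "V.indep_bound ?V (2 ^ length Z' * 2)"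
      using supported_on(3)[of ?N] unfolding len lenZ by (simp add: mult.commute)
  qed (use red ZZ(2) q(2) supported_on[of ?N] st IJ in auto)
  have IJ': "V.stable I V'" "V.stable J V'"
    using V'(4)[of I] V'(4)[of J] st IJ com q(1) by (auto simp: V.quat_pair_def)
  show ?thesis by (rule V.norm_isotropic[OF q(1) V'(2,1) IJ' V'(3)])
qed

text \<open>Coefficients count only modulo 2, so the inverse of a relation keeps its list, and a
  product corresponds to concatenation.\<close>

lemma milnor_subgroup_reducing:
  assumes "c \<in> milnor_subgroup TYPE('a)"
  shows "\<exists>L. V.reducing L \<and> (\<forall>p. even (poly_mapping.lookup c p - int (count (mset L) p)))"
proof -
  have rel: "\<exists>L. V.reducing L \<and> (\<forall>p. even (poly_mapping.lookup r p - int (count (mset L) p)))"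
    if r: "r \<in> milnor_relations TYPE('a)" for r
  proof -
    consider
        x y z where "x \<noteq> 0" "y \<noteq> 0" "z \<noteq> 0"
          "r = frag_of (x * y, z) - frag_of (x, z) - frag_of (y, z)"
      | x y z where "x \<noteq> 0" "y \<noteq> 0" "z \<noteq> 0"
          "r = frag_of (x, y * z) - frag_of (x, y) - frag_of (x, z)"
      | x where "x \<noteq> 0" "x \<noteq> 1" "r = frag_of (x, 1 - x)"
      using r unfolding milnor_relations_def by blast
    then show ?thesis
    proof cases
      case 1
      show ?thesis
        by (rule exI[of _ "[(x * y, z), (x, z), (y, z)]"])
          (use 1 in \<open>simp add: V.reducing_mult lookup_minus lookup_single when_def\<close>)
    next
      case 2
      then have "V.reducing [(x, y * z), (x, y), (x, z)]"
        using V.reducing_swap[OF V.reducing_mult[of y z x]] by simp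
      then show ?thesis
        by (intro exI[of _ "[(x, y * z), (x, y), (x, z)]"])
          (use 2 in \<open>simp add: lookup_minus lookup_single when_def\<close>)
    next
      case 3
      show ?thesis
        by (rule exI[of _ "[(x, 1 - x)]"])
          (use 3 in \<open>simp add: V.reducing_steinberg lookup_single when_def\<close>)
    qed
  qed
  show ?thesis
    using assms unfolding milnor_subgroup_def
  proof (induction rule: generate.induct)
    case one
    show ?case
      by (rule exI[of _ "[]"]) (simp add: V.reducing_Nil symbol_group_def)
  next
    case (incl h)
    then show ?case by (rule rel)
  next
    case (inv h)
    have "h \<in> carrier (symbol_group TYPE('a))" using inv milnor_relations_carrier by blast
    then have "inv\<^bsub>symbol_group TYPE('a)\<^esub> h = - h" by (simp add: symbol_group_def)
    moreover obtain L where "V.reducing L"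
      "\<And>p. even (poly_mapping.lookup h p - int (count (mset L) p))"
      using rel[OF inv] by blast
    ultimately show ?case by (intro exI[of _ L]) simp
  next
    case (eng g h)
    then obtain L M where
      L: "V.reducing L" "\<And>p. even (poly_mapping.lookup g p - int (count (mset L) p))" and
      M: "V.reducing M" "\<And>p. even (poly_mapping.lookup h p - int (count (mset M) p))"
      by blast
    have "even (poly_mapping.lookup (g + h) p - int (count (mset (L @ M)) p))" for p
      using L(2)[of p] M(2)[of p] by (simp add: lookup_add)
    then show ?case
      using V.reducing_append[OF L(1) M(1)] by (auto simp: symbol_group_def)
  qed
qed

text \<open>Unfolding the cosets gives \<open>frag_of (x, y) = m + (c + c)\<close> with
  \<open>m\<close> in the subgroup of relations. Modulo 2 the doubled part disappears, so the symbol
  and the list of \<open>m\<close> together have even multiplicities.\<close>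

lemma milnor_symbol_doubles_isotropic:
  assumes nz: "x \<noteq> 0" "y \<noteq> (0::'a)"
    and d: "milnor_symbol x y \<in> doubles (milnor_K2 TYPE('a))"
  shows "\<exists>p q r. (p \<noteq> 0 \<or> q \<noteq> 0 \<or> r \<noteq> 0) \<and> p\<^sup>2 - x * q\<^sup>2 - y * r\<^sup>2 = 0"
proof -
  let ?G = "symbol_group TYPE('a)" and ?M = "milnor_subgroup TYPE('a)"
  interpret G: comm_group ?G by (rule comm_group_symbol_group)
  interpret M: normal ?M ?G by (rule normal_milnor_subgroup)
  have mult: "g \<otimes>\<^bsub>?G\<^esub> h = g + h" for g h by (simp add: symbol_group_def)
  obtain C where C: "C \<in> carrier (milnor_K2 TYPE('a))"
    "milnor_symbol x y = C [^]\<^bsub>milnor_K2 TYPE('a)\<^esub> (2::nat)"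
    using d by (auto simp: doubles_def)
  obtain c where c: "c \<in> carrier ?G" "C = ?M #>\<^bsub>?G\<^esub> c"
    using C(1) by (auto simp: milnor_K2_def FactGroup_def RCOSETS_def)
  interpret K: comm_group "milnor_K2 TYPE('a)" by (rule comm_group_milnor_K2)
  have "C [^]\<^bsub>milnor_K2 TYPE('a)\<^esub> (2::nat) = C \<otimes>\<^bsub>milnor_K2 TYPE('a)\<^esub> C"
    using C(1) by (simp add: numeral_2_eq_2)
  also have "\<dots> = C <#>\<^bsub>?G\<^esub> C"
    by (simp add: milnor_K2_def)
  also have "\<dots> = ?M #>\<^bsub>?G\<^esub> (c + c)"
    using M.rcos_sum[OF c(1) c(1)] by (simp add: c(2) mult)
  finally have "?M #>\<^bsub>?G\<^esub> frag_of (x, y) = ?M #>\<^bsub>?G\<^esub> (c + c)"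
    using C(2) by (simp add: milnor_symbol_def)
  moreover have xy: "frag_of (x, y) \<in> carrier ?G" using nz by (simp add: symbol_group_def)
  ultimately have "frag_of (x, y) \<in> ?M #>\<^bsub>?G\<^esub> (c + c)"
    using G.rcos_self[OF xy M.subgroup_axioms] by simp
  then obtain m where m: "m \<in> ?M" "frag_of (x, y) = m + (c + c)"
    by (auto simp: r_coset_def mult)
  obtain L where L: "V.reducing L"
    "\<And>p. even (poly_mapping.lookup m p - int (count (mset L) p))"
    using milnor_subgroup_reducing[OF m(1)] by blast
  have "even (count (mset ((x, y) # L)) p)" for p
  proof -
    have "poly_mapping.lookup (frag_of (x, y)) p =
        poly_mapping.lookup m p + 2 * poly_mapping.lookup c p"
      by (simp add: m(2) lookup_add)
    then have "even (poly_mapping.lookup (frag_of (x, y)) p + int (count (mset L) p))"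
      using L(2)[of p] by simp
    then show ?thesis by (auto simp: lookup_single when_def split: if_splits)
  qed
  then show ?thesis using reducing_even_isotropic[OF L(1)] by blast
qed

end

section \<open>An anisotropic form over the rational function field\<close>

text \<open>With \<open>e = 1\<close> this is the reduction of the quaternion norm form after
  squaring. With \<open>e = 0\<close> its anisotropy in characteristic 2 says that
  \<open>1, A, B, A * B\<close> are independent over the squares.\<close>

definition kummer_form :: "'r::comm_ring_1 \<Rightarrow> 'r \<Rightarrow> 'r \<Rightarrow> 'r \<Rightarrow> 'r \<Rightarrow> 'r \<Rightarrow> 'r \<Rightarrow> 'r"
  where "kummer_form A B e P Q R U =
    P\<^sup>2 + A * Q\<^sup>2 + B * R\<^sup>2 + A * B * U\<^sup>2 + e * A * B * (P * U + Q * R)"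

text \<open>The descent step: once \<open>B\<close> divides the first two variables, a factor
  \<open>B\<close> comes out and the two pairs of variables change places.\<close>

lemma kummer_form_divide:
  "kummer_form A B e (B * P) (B * Q) R U = B * kummer_form A B e R U P Q"
  by (simp add: kummer_form_def algebra_simps power2_eq_square)

text \<open>For nonzero \<open>q\<close>, the degree of \<open>[:1, 1:] * q\<^sup>2\<close> is odd,
  whereas that of \<open>p\<^sup>2\<close> is even.\<close>

lemma bit_poly_square_eq_0:
  assumes "p\<^sup>2 + [:1, 1:] * q\<^sup>2 = (0 :: bit poly)"
  shows "p = 0 \<and> q = 0"
proof (cases "q = 0")
  case False
  have "p\<^sup>2 = - ([:1, 1:] * q\<^sup>2)" using assms by (rule eq_neg_iff_add_eq_0[THEN iffD2])
  then have "degree (p\<^sup>2) = degree ([:1, 1:] * q\<^sup>2)" by (simp only: degree_minus)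
  also have "\<dots> = Suc (2 * degree q)"
    using False by (subst degree_mult_eq) (auto simp: degree_power_eq)
  also have "degree (p\<^sup>2) = 2 * degree p"
    using degree_power_eq[of p 2] by (cases "p = 0") auto
  finally show ?thesis by presburger
qed (use assms in auto)

text \<open>The inner polynomial variable stands for the residue of \<open>a\<close>, the outer one
  for that of \<open>b\<close>.\<close>

definition A\<^sub>1 :: "bit poly poly" where "A\<^sub>1 = [:[:1, 1:]:]"
definition B\<^sub>1 :: "bit poly poly" where "B\<^sub>1 = [:1, 1:]"

lemma B1_neq_0: "B\<^sub>1 \<noteq> 0"
  by (simp add: B\<^sub>1_def)

lemma B1_dvd: "poly p 1 = 0 \<Longrightarrow> B\<^sub>1 dvd p"
proof -
  have "- 1 = (1 :: bit poly)" by (simp add: one_pCons)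
  then show "poly p 1 = 0 \<Longrightarrow> B\<^sub>1 dvd p" using poly_eq_0_iff_dvd[of p 1] by (simp add: B\<^sub>1_def)
qed

text \<open>
  Setting \<open>\<bb> = 1\<close> makes \<open>B\<close> vanish, so \<open>B\<close> divides \<open>P\<close> and \<open>Q\<close>; dividing by \<open>B\<close> yields a form of
  the same shape in \<open>R, U, P/B, Q/B\<close>.
\<close>

lemma kummer_form_poly_step:
  assumes "kummer_form A\<^sub>1 B\<^sub>1 e P Q R U = 0"
  obtains P' Q' where "P = B\<^sub>1 * P'" "Q = B\<^sub>1 * Q'" "kummer_form A\<^sub>1 B\<^sub>1 e R U P' Q' = 0"
proof -
  have ev: "poly A\<^sub>1 1 = [:1, 1:]" "poly B\<^sub>1 1 = 0"
    by (simp_all add: A\<^sub>1_def B\<^sub>1_def one_pCons)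
  have "poly (kummer_form A\<^sub>1 B\<^sub>1 e P Q R U) 1 = (poly P 1)\<^sup>2 + [:1, 1:] * (poly Q 1)\<^sup>2"
    by (simp only: kummer_form_def poly_add poly_mult poly_power ev) simp
  then have "0 = (poly P 1)\<^sup>2 + [:1, 1:] * (poly Q 1)\<^sup>2"
    by (simp only: assms poly_0)
  from bit_poly_square_eq_0[OF this[symmetric]] have "B\<^sub>1 dvd P" "B\<^sub>1 dvd Q"
    using B1_dvd by blast+
  then obtain P' Q' where PQ: "P = B\<^sub>1 * P'" "Q = B\<^sub>1 * Q'"
    by (elim dvdE)
  have "kummer_form A\<^sub>1 B\<^sub>1 e P Q R U = B\<^sub>1 * kummer_form A\<^sub>1 B\<^sub>1 e R U P' Q'"
    unfolding PQ by (rule kummer_form_divide)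
  then have "kummer_form A\<^sub>1 B\<^sub>1 e R U P' Q' = 0"
    using assms by (simp add: B1_neq_0)
  with PQ show thesis by (rule that)
qed

text \<open>Two descent steps restore the order of the variables and extract one factor
  \<open>B\<^sub>1\<close> from each. Hence all powers of \<open>B\<^sub>1\<close> divide all four,
  which is impossible for a nonzero polynomial by degree.\<close>

lemma kummer_form_poly_eq_0:
  assumes "kummer_form A\<^sub>1 B\<^sub>1 e P Q R U = 0"
  shows "P = 0 \<and> Q = 0 \<and> R = 0 \<and> U = 0"
proof -
  have dvd: "B\<^sub>1 ^ n dvd P \<and> B\<^sub>1 ^ n dvd Q \<and> B\<^sub>1 ^ n dvd R \<and> B\<^sub>1 ^ n dvd U" for n
    using assms
  proof (induction n arbitrary: P Q R U)
    case (Suc n)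
    obtain P' Q' where 1: "P = B\<^sub>1 * P'" "Q = B\<^sub>1 * Q'" "kummer_form A\<^sub>1 B\<^sub>1 e R U P' Q' = 0"
      using kummer_form_poly_step[OF Suc.prems] .
    obtain R' U' where 2: "R = B\<^sub>1 * R'" "U = B\<^sub>1 * U'" "kummer_form A\<^sub>1 B\<^sub>1 e P' Q' R' U' = 0"
      using kummer_form_poly_step[OF 1(3)] .
    show ?case
      using Suc.IH[OF 2(3)] unfolding 1(1,2) 2(1,2) power_Suc by (simp add: mult_dvd_mono)
  qed simp
  have "p = 0" if "\<And>n. B\<^sub>1 ^ n dvd p" for p
  proof (rule ccontr)
    assume "p \<noteq> 0"
    then have "degree (B\<^sub>1 ^ Suc (degree p)) \<le> degree p"
      using that dvd_imp_degree_le by blast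
    moreover have "degree (B\<^sub>1 ^ Suc (degree p)) = Suc (degree p)"
      by (subst degree_power_eq) (auto simp: B\<^sub>1_def)
    ultimately show False by simp
  qed
  then show ?thesis using dvd by blast
qed

lemma kummer_form_scale:
  "kummer_form A B e (c * P) (c * Q) (c * R) (c * U) = c\<^sup>2 * kummer_form A B e P Q R U"
  by (simp add: kummer_form_def algebra_simps power2_eq_square)

text \<open>The form is homogeneous, so multiplying by the common denominator \<open>c\<close>
  reduces the claim to polynomials.\<close>

lemma kummer_form_F2_rat2_eq_0:
  assumes "kummer_form (1 + F2_indet_a) (1 + F2_indet_b) (of_bool e) P Q R U = 0"
  shows "P = 0 \<and> Q = 0 \<and> R = 0 \<and> U = 0"
proof -
  have AB: "1 + F2_indet_a = to_fract A\<^sub>1" "1 + F2_indet_b = to_fract B\<^sub>1"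
    unfolding F2_indet_a_def F2_indet_b_def to_fract_def
    by (simp_all add: One_fract_def one_pCons A\<^sub>1_def B\<^sub>1_def)
  have frac: "\<exists>p q. q \<noteq> 0 \<and> to_fract q * x = to_fract p" for x :: F2_rat2
  proof (cases x rule: Fract_cases)
    case (Fract p q)
    then show ?thesis
      by (intro exI[of _ p] exI[of _ q]) (simp add: Fract_conv_to_fract)
  qed
  obtain p p' q q' r r' u u' where d:
    "p' \<noteq> 0" "to_fract p' * P = to_fract p" "q' \<noteq> 0" "to_fract q' * Q = to_fract q"
    "r' \<noteq> 0" "to_fract r' * R = to_fract r" "u' \<noteq> 0" "to_fract u' * U = to_fract u"
    using frac[of P] frac[of Q] frac[of R] frac[of U] by blast
  define c where "c = to_fract (p' * q' * r' * u')"
  have c0: "c \<noteq> 0" using d by (simp add: c_def)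
  have c: "c * P = to_fract (p * q' * r' * u')" "c * Q = to_fract (q * p' * r' * u')"
    "c * R = to_fract (r * p' * q' * u')" "c * U = to_fract (u * p' * q' * r')"
    by (simp_all add: c_def flip: d(2,4,6,8))
  have "to_fract (kummer_form A\<^sub>1 B\<^sub>1 (of_bool e)
      (p * q' * r' * u') (q * p' * r' * u') (r * p' * q' * u') (u * p' * q' * r')) =
    kummer_form (to_fract A\<^sub>1) (to_fract B\<^sub>1) (of_bool e) (c * P) (c * Q) (c * R) (c * U)"
    unfolding kummer_form_def c power2_eq_square by (cases e) simp_all
  also have "\<dots> = 0" using assms by (simp only: kummer_form_scale AB) simp
  finally have "kummer_form A\<^sub>1 B\<^sub>1 (of_bool e)
      (p * q' * r' * u') (q * p' * r' * u') (r * p' * q' * u') (u * p' * q' * r') = 0"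
    by simp
  from kummer_form_poly_eq_0[OF this] have "c * P = 0 \<and> c * Q = 0 \<and> c * R = 0 \<and> c * U = 0"
    unfolding c by simp
  then show ?thesis using c0 by simp
qed

section \<open>Absolute values on quadratic extensions\<close>

text \<open>All fields of the tower are subsets of one type. Absolute values are real so that a
  ramified extension can take square roots of them.\<close>

locale nonarch_subfield =
  fixes F :: "'l::field set" and N :: "'l \<Rightarrow> real"
  assumes one_mem: "1 \<in> F"
    and diff_mem: "x \<in> F \<Longrightarrow> y \<in> F \<Longrightarrow> x - y \<in> F"
    and mult_mem: "x \<in> F \<Longrightarrow> y \<in> F \<Longrightarrow> x * y \<in> F"
    and inverse_mem: "x \<in> F \<Longrightarrow> inverse x \<in> F"
    and N_nonneg: "x \<in> F \<Longrightarrow> 0 \<le> N x"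
    and N_eq_0: "x \<in> F \<Longrightarrow> N x = 0 \<longleftrightarrow> x = 0"
    and N_mult: "x \<in> F \<Longrightarrow> y \<in> F \<Longrightarrow> N (x * y) = N x * N y"
    and N_add: "x \<in> F \<Longrightarrow> y \<in> F \<Longrightarrow> N (x + y) \<le> max (N x) (N y)"
begin

lemma zero_mem: "0 \<in> F"
  using diff_mem[OF one_mem one_mem] by simp

lemma uminus_mem: "x \<in> F \<Longrightarrow> - x \<in> F"
  using diff_mem[OF zero_mem] by simp

lemma add_mem: "x \<in> F \<Longrightarrow> y \<in> F \<Longrightarrow> x + y \<in> F"
  using diff_mem[OF _ uminus_mem] by fastforce

lemma power2_mem: "x \<in> F \<Longrightarrow> x\<^sup>2 \<in> F"
  by (simp add: power2_eq_square mult_mem)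

lemma two_mem: "2 \<in> F"
  using add_mem[OF one_mem one_mem] by simp

lemmas mem = zero_mem one_mem two_mem uminus_mem add_mem diff_mem mult_mem inverse_mem power2_mem

lemma N_0: "N 0 = 0" and N_1: "N 1 = 1"
proof -
  show "N 0 = 0" using N_eq_0 zero_mem by simp
  have "N 1 * N 1 = N 1" using N_mult[OF one_mem one_mem] by simp
  then show "N 1 = 1" using N_eq_0[OF one_mem] by simp
qed

lemma N_uminus: "x \<in> F \<Longrightarrow> N (- x) = N x"
proof -
  assume x: "x \<in> F"
  have "N (-1) * N (-1) = 1" using N_mult[of "-1" "-1"] uminus_mem[OF one_mem] N_1 by simp
  moreover have "0 \<le> N (-1)" using N_nonneg uminus_mem[OF one_mem] by simp
  ultimately have "N (-1) = 1" by (metis abs_of_nonneg mult_cancel_left1 power2_eq_square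
      real_sqrt_abs real_sqrt_one)
  then show ?thesis using N_mult[of "-1" x] x uminus_mem[OF one_mem] by simp
qed

lemma N_diff: "x \<in> F \<Longrightarrow> y \<in> F \<Longrightarrow> N (x - y) \<le> max (N x) (N y)"
  using N_add[of x "- y"] N_uminus uminus_mem by simp

lemma N_power2: "x \<in> F \<Longrightarrow> N (x\<^sup>2) = (N x)\<^sup>2"
  by (simp add: power2_eq_square N_mult)

lemma N_add_eq:
  assumes "x \<in> F" "y \<in> F" "N y < N x"
  shows "N (x + y) = N x"
proof -
  have "N x \<le> max (N (x + y)) (N y)"
    using N_diff[of "x + y" y] assms add_mem by simp
  then show ?thesis using N_add[OF assms(1,2)] assms(3) by simp
qed

lemma N_diff_eq:
  assumes "x \<in> F" "y \<in> F" "N y < N x"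
  shows "N (x - y) = N x"
  using N_add_eq[of x "- y"] assms N_uminus uminus_mem by simp

lemma N_inverse: "x \<in> F \<Longrightarrow> x \<noteq> 0 \<Longrightarrow> N (inverse x) = inverse (N x)"
  using N_mult[of x "inverse x"] inverse_mem N_1 by (simp add: inverse_unique)

end

definition quad_field :: "'l::field set \<Rightarrow> 'l \<Rightarrow> 'l set"
  where "quad_field F \<delta> = {x + y * \<delta> | x y. x \<in> F \<and> y \<in> F}"

text \<open>The usual extension of an absolute value: the square root of the value of the field
  norm. The coordinates are unique under the hypotheses of \<open>quad_extension\<close>, which
  justifies \<open>THE\<close>.\<close>

definition quad_norm :: "'l::field set \<Rightarrow> ('l \<Rightarrow> real) \<Rightarrow> 'l \<Rightarrow> 'l \<Rightarrow> real"
  where "quad_norm F N \<delta> z =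
    (THE r. \<exists>x\<in>F. \<exists>y\<in>F. z = x + y * \<delta> \<and> r = sqrt (N (x\<^sup>2 - \<delta>\<^sup>2 * y\<^sup>2)))"

text \<open>
  The hypothesis \<open>norm_form\<close> says that the quadratic extension is either totally ramified, or
  has residue degree \<open>2\<close>, with \<open>1, \<delta>\<close> a norm-orthogonal basis.
\<close>

locale quad_extension = nonarch_subfield F N
  for F :: "'l::field set" and N :: "'l \<Rightarrow> real" +
  fixes \<delta> :: 'l
  assumes sq_mem: "\<delta>\<^sup>2 \<in> F" and gen_neq_0: "\<delta> \<noteq> 0"
    and norm_form: "x \<in> F \<Longrightarrow> y \<in> F \<Longrightarrow> N (x\<^sup>2 - \<delta>\<^sup>2 * y\<^sup>2) = max ((N x)\<^sup>2) (N (\<delta>\<^sup>2) * (N y)\<^sup>2)"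
begin

lemma gen_sq_pos: "0 < N (\<delta>\<^sup>2)"
  using N_eq_0[OF sq_mem] N_nonneg[OF sq_mem] gen_neq_0 by simp

text \<open>Anisotropy of the norm form; it makes coordinates with respect to \<open>1\<close> and
  \<delta> unique.\<close>

lemma norm_form_eq_0:
  assumes "x \<in> F" "y \<in> F" "x\<^sup>2 - \<delta>\<^sup>2 * y\<^sup>2 = 0"
  shows "x = 0 \<and> y = 0"
proof -
  have "max ((N x)\<^sup>2) (N (\<delta>\<^sup>2) * (N y)\<^sup>2) = 0"
    using norm_form[OF assms(1,2)] assms(3) N_0 by simp
  moreover have "0 \<le> N (\<delta>\<^sup>2) * (N y)\<^sup>2" using gen_sq_pos by simp
  ultimately have "(N x)\<^sup>2 = 0" "N (\<delta>\<^sup>2) * (N y)\<^sup>2 = 0"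
    by (smt (verit) zero_le_power2)+
  then show ?thesis using N_eq_0 assms(1,2) gen_sq_pos by simp
qed

lemma coords_unique:
  assumes "x \<in> F" "y \<in> F" "x' \<in> F" "y' \<in> F" "x + y * \<delta> = x' + y' * \<delta>"
  shows "x = x' \<and> y = y'"
proof -
  have "x - x' = (y' - y) * \<delta>" using assms(5) by (simp add: algebra_simps)
  then have "(x - x')\<^sup>2 - \<delta>\<^sup>2 * (y' - y)\<^sup>2 = 0" by (simp add: power_mult_distrib)
  then show ?thesis using norm_form_eq_0[of "x - x'" "y' - y"] assms diff_mem by simp
qed

lemma quad_norm_eq:
  assumes "x \<in> F" "y \<in> F"
  shows "quad_norm F N \<delta> (x + y * \<delta>) = sqrt (N (x\<^sup>2 - \<delta>\<^sup>2 * y\<^sup>2))"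
  unfolding quad_norm_def
proof (rule the_equality)
  fix r assume "\<exists>x'\<in>F. \<exists>y'\<in>F. x + y * \<delta> = x' + y' * \<delta> \<and> r = sqrt (N (x'\<^sup>2 - \<delta>\<^sup>2 * y'\<^sup>2))"
  then show "r = sqrt (N (x\<^sup>2 - \<delta>\<^sup>2 * y\<^sup>2))" using coords_unique[OF assms] by blast
qed (use assms in blast)

lemma quad_norm_max:
  assumes "x \<in> F" "y \<in> F"
  shows "quad_norm F N \<delta> (x + y * \<delta>) = max (N x) (sqrt (N (\<delta>\<^sup>2)) * N y)"
proof -
  have "sqrt (max s t) = max (sqrt s) (sqrt t)" for s t :: real
    by (simp add: max_def)
  then show ?thesis
    using quad_norm_eq[OF assms] norm_form[OF assms] N_nonneg assms
    by (simp add: real_sqrt_mult)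
qed

lemma quad_norm_base: "x \<in> F \<Longrightarrow> quad_norm F N \<delta> x = N x"
  using quad_norm_max[of x 0] zero_mem N_0 N_nonneg[of x] by simp

lemma base_subset: "F \<subseteq> quad_field F \<delta>"
  unfolding quad_field_def using zero_mem by force

lemma gen_mem: "\<delta> \<in> quad_field F \<delta>"
  unfolding quad_field_def using zero_mem one_mem by force

text \<open>Multiplicativity comes from multiplicativity of the field norm, the ultrametric
  inequality from the description as a maximum, and inverses from the conjugate.\<close>

lemma nonarch_subfield_quad: "nonarch_subfield (quad_field F \<delta>) (quad_norm F N \<delta>)"
proof
  show "1 \<in> quad_field F \<delta>" using base_subset one_mem by blast
next
  fix z w assume "z \<in> quad_field F \<delta>" "w \<in> quad_field F \<delta>"
  then obtain x y x' y' where m: "x \<in> F" "y \<in> F" "x' \<in> F" "y' \<in> F"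
    and z: "z = x + y * \<delta>" and w: "w = x' + y' * \<delta>"
    unfolding quad_field_def by blast
  have "z - w = (x - x') + (y - y') * \<delta>" by (simp add: z w algebra_simps)
  then show "z - w \<in> quad_field F \<delta>" unfolding quad_field_def using m diff_mem by blast
  have zw: "z * w = (x * x' + \<delta>\<^sup>2 * (y * y')) + (x * y' + y * x') * \<delta>"
    by (simp add: z w algebra_simps power2_eq_square)
  have m': "x * x' + \<delta>\<^sup>2 * (y * y') \<in> F" "x * y' + y * x' \<in> F"
    using m sq_mem by (simp_all add: mem)
  show "z * w \<in> quad_field F \<delta>" unfolding quad_field_def zw using m' by blast
  have "(x * x' + \<delta>\<^sup>2 * (y * y'))\<^sup>2 - \<delta>\<^sup>2 * (x * y' + y * x')\<^sup>2 =
      (x\<^sup>2 - \<delta>\<^sup>2 * y\<^sup>2) * (x'\<^sup>2 - \<delta>\<^sup>2 * y'\<^sup>2)"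
    by (simp add: algebra_simps power2_eq_square)
  moreover have "x\<^sup>2 - \<delta>\<^sup>2 * y\<^sup>2 \<in> F" "x'\<^sup>2 - \<delta>\<^sup>2 * y'\<^sup>2 \<in> F" using m sq_mem by (simp_all add: mem)
  ultimately show "quad_norm F N \<delta> (z * w) = quad_norm F N \<delta> z * quad_norm F N \<delta> w"
    unfolding zw quad_norm_eq[OF m'] unfolding z w
    using quad_norm_eq m by (simp add: N_mult real_sqrt_mult)
  have "z + w = (x + x') + (y + y') * \<delta>" by (simp add: z w algebra_simps)
  then have "quad_norm F N \<delta> (z + w) = max (N (x + x')) (sqrt (N (\<delta>\<^sup>2)) * N (y + y'))"
    using quad_norm_max m add_mem by simp
  also have "\<dots> \<le> max (max (N x) (N x')) (sqrt (N (\<delta>\<^sup>2)) * max (N y) (N y'))"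
    using N_add m gen_sq_pos by (intro max.mono mult_left_mono) auto
  also have "\<dots> = max (quad_norm F N \<delta> z) (quad_norm F N \<delta> w)"
    unfolding z w quad_norm_max[OF m(1,2)] quad_norm_max[OF m(3,4)]
    using gen_sq_pos by (simp add: max_mult_distrib_left max.assoc max.left_commute)
  finally show "quad_norm F N \<delta> (z + w) \<le> max (quad_norm F N \<delta> z) (quad_norm F N \<delta> w)" .
next
  fix z assume "z \<in> quad_field F \<delta>"
  then obtain x y where m: "x \<in> F" "y \<in> F" and z: "z = x + y * \<delta>"
    unfolding quad_field_def by blast
  define n where "n = x\<^sup>2 - \<delta>\<^sup>2 * y\<^sup>2"
  have n: "n \<in> F" unfolding n_def using m sq_mem by (simp add: mem)
  show "0 \<le> quad_norm F N \<delta> z" unfolding z quad_norm_eq[OF m] using n N_nonneg n_def by simp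
  have z0: "n = 0 \<longleftrightarrow> z = 0"
    using norm_form_eq_0[OF m] coords_unique[OF m zero_mem zero_mem]
    by (auto simp: n_def z)
  then show "quad_norm F N \<delta> z = 0 \<longleftrightarrow> z = 0"
    unfolding z quad_norm_eq[OF m] using N_eq_0[OF n] by (simp add: n_def)
  show "inverse z \<in> quad_field F \<delta>"
  proof (cases "z = 0")
    case True
    then show ?thesis using base_subset zero_mem by auto
  next
    case False
    have "z * (x - y * \<delta>) = n" by (simp add: z n_def algebra_simps power2_eq_square)
    then have "inverse z = (x - y * \<delta>) * inverse n"
      using False z0 by (simp add: field_simps)
    also have "\<dots> = x * inverse n + (- y * inverse n) * \<delta>" by (simp add: algebra_simps)
    finally have "inverse z = x * inverse n + (- y * inverse n) * \<delta>" .
    moreover have "x * inverse n \<in> F" "- y * inverse n \<in> F" using m n by (simp_all only: mem)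
    ultimately show ?thesis unfolding quad_field_def by blast
  qed
qed

end

section \<open>The residue field\<close>

context discrete_valued_field
begin

lemma val_one: "v 1 = 0"
  using val_mult[of 1 1] by simp

lemma val_uminus: "v (- x) = v x"
proof (cases "x = 0")
  case False
  have "v (-1) + v (-1) = 0" using val_mult[of "-1" "-1"] val_one by simp
  then have "v (-1) = 0" by simp
  then show ?thesis using val_mult[of "-1" x] False by simp
qed simp

lemma val_ge_simps: "val_ge v n 0" "val_ge v 0 1"
  "val_ge v n x \<Longrightarrow> val_ge v n y \<Longrightarrow> val_ge v n (x + y)"
  "val_ge v n (- x) \<longleftrightarrow> val_ge v n x"
  "val_ge v 0 x \<Longrightarrow> val_ge v n y \<Longrightarrow> val_ge v n (x * y)"
  "val_ge v n x \<Longrightarrow> val_ge v 0 y \<Longrightarrow> val_ge v n (x * y)"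
proof -
  show "val_ge v n (x + y)" if "val_ge v n x" "val_ge v n y"
    using that val_add[of x y] unfolding val_ge_def
    by (cases "x = 0"; cases "y = 0"; cases "x + y = 0") auto
  show "val_ge v n (x * y)" if "val_ge v 0 x" "val_ge v n y"
    using that val_mult[of x y] by (cases "x = 0"; cases "y = 0") (auto simp: val_ge_def)
  show "val_ge v n (x * y)" if "val_ge v n x" "val_ge v 0 y"
    using that val_mult[of x y] by (cases "x = 0"; cases "y = 0") (auto simp: val_ge_def)
qed (simp_all add: val_ge_def val_one val_uminus)

lemma cring_valuation_ring: "cring (valuation_ring v)"
proof (rule cringI)
  show "abelian_group (valuation_ring v)"
  proof (rule abelian_groupI)
    fix x assume x: "x \<in> carrier (valuation_ring v)"
    then show "\<exists>y\<in>carrier (valuation_ring v). y \<oplus>\<^bsub>valuation_ring v\<^esub> x = \<zero>\<^bsub>valuation_ring v\<^esub>"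
      by (intro bexI[of _ "- x"]) (auto simp: valuation_ring_def ring_of_type_algebra_def val_ge_simps)
  qed (auto simp: valuation_ring_def ring_of_type_algebra_def val_ge_simps)
  show "Group.comm_monoid (valuation_ring v)"
    by (rule Group.comm_monoidI)
      (auto simp: valuation_ring_def ring_of_type_algebra_def val_ge_simps)
qed (auto simp: valuation_ring_def ring_of_type_algebra_def algebra_simps)

lemma ideal_valuation_ideal: "ideal (valuation_ideal v) (valuation_ring v)"
proof -
  interpret R: cring "valuation_ring v" by (rule cring_valuation_ring)
  have min: "\<ominus>\<^bsub>valuation_ring v\<^esub> x = - x" if "val_ge v 0 x" for x
    by (rule R.minus_equality) (use that in \<open>auto simp: valuation_ring_def ring_of_type_algebra_def val_ge_simps\<close>)
  have sub: "val_ge v 1 x \<Longrightarrow> val_ge v 0 x" for x by (auto simp: val_ge_def)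
  show ?thesis
  proof (rule idealI)
    show "ring (valuation_ring v)" by (rule R.ring_axioms)
    show "subgroup (valuation_ideal v) (add_monoid (valuation_ring v))"
    proof (rule R.add.subgroupI)
      fix x assume "x \<in> valuation_ideal v"
      then show "\<ominus>\<^bsub>valuation_ring v\<^esub> x \<in> valuation_ideal v"
        using min sub by (auto simp: valuation_ideal_def val_ge_simps)
    qed (use sub in \<open>auto simp: valuation_ideal_def valuation_ring_def ring_of_type_algebra_def val_ge_simps
        intro: exI[of _ 0]\<close>)
  qed (auto simp: valuation_ideal_def valuation_ring_def ring_of_type_algebra_def val_ge_simps)
qed

end

locale residue_iso = discrete_valued_field v for v :: "'k::field \<Rightarrow> int" +
  fixes \<phi> :: "'k set \<Rightarrow> 'r::field"
  assumes iso: "\<phi> \<in> ring_iso (residue_field v) ring_of_type_algebra"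
begin

definition res :: "'k \<Rightarrow> 'r"
  where "res x = \<phi> (residue_class v x)"

sublocale I: ideal "valuation_ideal v" "valuation_ring v"
  by (rule ideal_valuation_ideal)

lemma res_hom: "res \<in> ring_hom (valuation_ring v) ring_of_type_algebra"
proof -
  have "\<phi> \<circ> residue_class v \<in> ring_hom (valuation_ring v) ring_of_type_algebra"
  proof (rule ring_hom_trans)
    show "residue_class v \<in> ring_hom (valuation_ring v) (residue_field v)"
      using I.rcos_ring_hom by (simp add: residue_class_def[abs_def] residue_field_def)
    show "\<phi> \<in> ring_hom (residue_field v) ring_of_type_algebra"
      using iso by (simp add: ring_iso_def)
  qed
  then show ?thesis by (simp add: comp_def res_def[abs_def])
qed

lemma res_simps:
  assumes "val_ge v 0 x" "val_ge v 0 y"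
  shows "res (x + y) = res x + res y" "res (x * y) = res x * res y" "res 1 = 1"
  using ring_hom_add[OF res_hom, of x y] ring_hom_mult[OF res_hom, of x y] ring_hom_one[OF res_hom]
    assms
  by (simp_all add: valuation_ring_def ring_of_type_algebra_def)

lemma res_eq_0_iff:
  assumes "val_ge v 0 x"
  shows "res x = 0 \<longleftrightarrow> val_ge v 1 x"
proof -
  have inj: "inj_on \<phi> (carrier (residue_field v))"
    using iso by (auto simp: ring_iso_def bij_betw_def)
  have mem: "residue_class v y \<in> carrier (residue_field v)" if "val_ge v 0 y" for y
    using ring_hom_closed[OF I.rcos_ring_hom, of y] that
    by (simp add: residue_class_def residue_field_def valuation_ring_def ring_of_type_algebra_def)
  have 0: "val_ge v 0 0" by (simp add: val_ge_def)
  have "res 0 + res 0 = res 0 + 0" using res_simps(1)[OF 0 0] by (simp only: add_0_left add_0_right)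
  then have "res 0 = 0" by (simp only: add_left_cancel)
  then have "res x = 0 \<longleftrightarrow> residue_class v x = residue_class v 0"
    unfolding res_def using inj_onD[OF inj] mem[OF assms] mem[OF 0] by metis
  also have "residue_class v 0 = valuation_ideal v"
    by (auto simp: residue_class_def a_r_coset_def r_coset_def valuation_ring_def ring_of_type_algebra_def)
  also have "residue_class v x = valuation_ideal v \<longleftrightarrow> x \<in> valuation_ideal v"
  proof
    assume e: "residue_class v x = valuation_ideal v"
    have "0 + x \<in> residue_class v x"
      unfolding residue_class_def a_r_coset_def r_coset_def
      by (auto simp: valuation_ideal_def val_ge_def valuation_ring_def ring_of_type_algebra_def)
    then show "x \<in> valuation_ideal v" using e by simp
  next
    assume "x \<in> valuation_ideal v"
    then show "residue_class v x = valuation_ideal v"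
      unfolding residue_class_def by (rule I.a_rcos_const)
  qed
  finally show ?thesis by (simp add: valuation_ideal_def)
qed

end

text \<open>Base 2 is chosen so that the uniformizer 2 gets the value \<open>1 / 2\<close>.\<close>

definition val_abs :: "('a::field \<Rightarrow> int) \<Rightarrow> 'a \<Rightarrow> real"
  where "val_abs v x = (if x = 0 then 0 else 2 powr (- real_of_int (v x)))"

context discrete_valued_field
begin

lemma val_abs_le_1: "val_abs v x \<le> 1 \<longleftrightarrow> val_ge v 0 x"
  and val_abs_less_1: "val_abs v x < 1 \<longleftrightarrow> val_ge v 1 x"
  using powr_le_cancel_iff[of 2 "- real_of_int (v x)" 0] powr_less_cancel_iff[of 2 "- real_of_int (v x)" 0]
  by (auto simp: val_abs_def val_ge_def)

lemma nonarch_val_abs: "nonarch_subfield UNIV (val_abs v)"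
proof
  fix x y :: 'a
  show "val_abs v (x * y) = val_abs v x * val_abs v y"
    by (simp add: val_abs_def val_mult powr_add[symmetric])
  show "val_abs v (x + y) \<le> max (val_abs v x) (val_abs v y)"
  proof (cases "x = 0 \<or> y = 0 \<or> x + y = 0")
    case True
    then show ?thesis by (auto simp: val_abs_def le_max_iff_disj)
  next
    case False
    then have "min (v x) (v y) \<le> v (x + y)" using val_add by simp
    then show ?thesis using False by (auto simp: val_abs_def max_def min_def split: if_splits)
  qed
qed (auto simp: val_abs_def)

end

text \<open>The residues of \<open>a\<close> and \<open>b\<close> form a 2-basis: together with
  \<open>1\<close> and their product they are a basis of the residue field over its squares.\<close>

locale valued_2_basis = residue_iso v \<phi>
  for v :: "'k::field_char_0 \<Rightarrow> int" and \<phi> :: "'k set \<Rightarrow> F2_rat2" +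
  fixes a b :: 'k
  assumes val_2: "v 2 = 1"
    and int_a: "val_ge v 0 a" and res_a: "res a = F2_indet_a"
    and int_b: "val_ge v 0 b" and res_b: "res b = F2_indet_b"
begin

sublocale K: nonarch_subfield UNIV "val_abs v"
  by (rule nonarch_val_abs)

lemma val_abs_2: "val_abs v 2 = 1 / 2"
  by (simp add: val_abs_def val_2 powr_minus)

lemma int_two: "val_ge v 1 2"
  by (simp add: val_ge_def val_2)

lemma int_weaken: "val_ge v 1 x \<Longrightarrow> val_ge v 0 x"
  by (auto simp: val_ge_def)

lemma int_power2: "val_ge v 0 x \<Longrightarrow> val_ge v 0 (x\<^sup>2)"
  by (simp add: power2_eq_square val_ge_simps)

lemma val_ge_diff: "val_ge v n x \<Longrightarrow> val_ge v n y \<Longrightarrow> val_ge v n (x - y)"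
  using val_ge_simps(3)[of n x "- y"] by (simp add: val_ge_simps)

lemma kummer_form_residue:
  assumes "val_ge v 0 P" "val_ge v 0 Q" "val_ge v 0 R" "val_ge v 0 U"
    and "val_ge v 1 (kummer_form (1 + a) (1 + b) (of_bool e) P Q R U)"
  shows "val_ge v 1 P \<and> val_ge v 1 Q \<and> val_ge v 1 R \<and> val_ge v 1 U"
proof -
  have "res (kummer_form (1 + a) (1 + b) (of_bool e) P Q R U) =
      kummer_form (1 + F2_indet_a) (1 + F2_indet_b) (of_bool e) (res P) (res Q) (res R) (res U)"
    using assms(1-4) int_a int_b
    by (cases e) (simp_all add: kummer_form_def power2_eq_square res_simps val_ge_simps res_a res_b)
  moreover have "res (kummer_form (1 + a) (1 + b) (of_bool e) P Q R U) = 0"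
    using res_eq_0_iff int_weaken assms(5) by blast
  ultimately show ?thesis
    using kummer_form_F2_rat2_eq_0[of e "res P" "res Q" "res R" "res U"] res_eq_0_iff assms(1-4)
    by simp
qed

definition basis_form :: "'k \<Rightarrow> 'k \<Rightarrow> 'k \<Rightarrow> 'k \<Rightarrow> 'k"
  where "basis_form x y z w = x\<^sup>2 + a * y\<^sup>2 + b * z\<^sup>2 + a * b * w\<^sup>2"

text \<open>Squaring is additive modulo 2, so a linear change of variables replaces the basis
  \<open>1, a, b, a * b\<close> by \<open>1, 1 + a, 1 + b, (1 + a) * (1 + b)\<close>. The error is
  \<open>2 * E\<close>.\<close>

lemma basis_form_residue:
  assumes i: "val_ge v 0 x" "val_ge v 0 y" "val_ge v 0 z" "val_ge v 0 w"
    and q: "val_ge v 1 (basis_form x y z w)"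
  shows "val_ge v 1 x \<and> val_ge v 1 y \<and> val_ge v 1 z \<and> val_ge v 1 w"
proof -
  define E where "E = y\<^sup>2 + z\<^sup>2 + (2 + a + b) * w\<^sup>2 + (x * y + x * z + x * w + y * z + y * w + z * w)
    + (1 + a) * y * w + (1 + b) * z * w"
  have "val_ge v 0 E"
    unfolding E_def using i int_a int_b int_weaken[OF int_two]
    by (simp add: val_ge_simps int_power2)
  then have "val_ge v 1 (2 * E)" by (rule val_ge_simps(6)[OF int_two])
  moreover have "kummer_form (1 + a) (1 + b) (of_bool False) (x + y + z + w) (y + w) (z + w) w =
      basis_form x y z w + 2 * E"
    by (simp add: kummer_form_def basis_form_def E_def algebra_simps power2_eq_square)
  ultimately have "val_ge v 1 (x + y + z + w) \<and> val_ge v 1 (y + w) \<and> val_ge v 1 (z + w) \<and> val_ge v 1 w"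
    using kummer_form_residue[of "x + y + z + w" "y + w" "z + w" w False] i q
    by (simp add: val_ge_simps)
  then have w: "val_ge v 1 w" and "val_ge v 1 (y + w - w)" "val_ge v 1 (z + w - w)"
    "val_ge v 1 (x + y + z + w - (y + w) - (z + w) + w)"
    by (simp_all only: val_ge_diff val_ge_simps(3))
  then show ?thesis by simp
qed

lemma basis_form_scale: "basis_form (c * x) (c * y) (c * z) (c * w) = c\<^sup>2 * basis_form x y z w"
  by (simp add: basis_form_def algebra_simps power_mult_distrib)

text \<open>Divide by an entry \<open>c\<close> of largest value: all entries become integral and
  one becomes a unit, so by \<open>basis_form_residue\<close> the form takes a unit value.\<close>

lemma val_abs_basis_form:
  "val_abs v (basis_form x y z w) =
    (Max {val_abs v x, val_abs v y, val_abs v z, val_abs v w})\<^sup>2"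
proof -
  let ?S = "{val_abs v x, val_abs v y, val_abs v z, val_abs v w}"
  let ?M = "Max ?S"
  have "?M \<in> ?S" by (rule Max_in) auto
  then have "?M \<in> val_abs v ` {x, y, z, w}" by (simp only: image_insert image_empty)
  then obtain c where c: "c \<in> {x, y, z, w}" "val_abs v c = ?M" by (metis imageE)
  have le: "val_abs v t \<le> val_abs v c" if "t \<in> {x, y, z, w}" for t
    unfolding c(2) by (rule Max_ge) (use that in auto)
  show ?thesis
  proof (cases "c = 0")
    case True
    then have "val_abs v t = 0" if "t \<in> {x, y, z, w}" for t
      using le[OF that] K.N_0 K.N_nonneg[of t] by simp
    then have "x = 0" "y = 0" "z = 0" "w = 0" using K.N_eq_0 by auto
    then show ?thesis by (simp add: basis_form_def K.N_0)
  next
    case False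
    have c0: "0 < val_abs v c" using False K.N_eq_0[of c] K.N_nonneg[of c] by simp
    have n: "val_abs v (inverse c * t) = val_abs v t / val_abs v c" for t
      using K.N_mult[of "inverse c" t] K.N_inverse[of c] False by (simp add: field_simps)
    have i: "val_ge v 0 (inverse c * t)" if "t \<in> {x, y, z, w}" for t
      unfolding val_abs_le_1[symmetric] n using le[OF that] c0 by simp
    have "\<not> val_ge v 1 (inverse c * c)"
      unfolding val_abs_less_1[symmetric] n using c0 by simp
    then have "\<not> val_ge v 1 (basis_form (inverse c * x) (inverse c * y) (inverse c * z) (inverse c * w))"
      using basis_form_residue[of "inverse c * x" "inverse c * y" "inverse c * z" "inverse c * w"] i c(1)
      by auto
    moreover have "val_ge v 0 (basis_form (inverse c * x) (inverse c * y) (inverse c * z) (inverse c * w))"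
      unfolding basis_form_def using i int_a int_b by (simp add: val_ge_simps int_power2)
    ultimately have "val_abs v (basis_form (inverse c * x) (inverse c * y) (inverse c * z) (inverse c * w)) = 1"
      unfolding val_abs_le_1[symmetric] val_abs_less_1[symmetric] by simp
    then have "inverse (val_abs v c) ^ 2 * val_abs v (basis_form x y z w) = 1"
      unfolding basis_form_scale by (simp add: K.N_mult K.N_power2 K.N_inverse False)
    then show ?thesis unfolding c(2)[symmetric] using c0 by (simp add: field_simps)
  qed
qed

end

section \<open>Value groups and residue fields in quadratic extensions\<close>

definition dyadic_norm :: "'l::field set \<Rightarrow> ('l \<Rightarrow> real) \<Rightarrow> bool"
  where "dyadic_norm F N \<longleftrightarrow> (\<forall>x\<in>F. x = 0 \<or> (\<exists>n::int. N x = 2 powr n))"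

text \<open>The squares of the residue field of \<open>F\<close> lie in the image of \<open>C\<close>.\<close>

definition squares_lift :: "'l::field set \<Rightarrow> ('l \<Rightarrow> real) \<Rightarrow> 'l set \<Rightarrow> bool"
  where "squares_lift F N C \<longleftrightarrow> (\<forall>x\<in>F. N x \<le> 1 \<longrightarrow> (\<exists>c\<in>C. N (x\<^sup>2 - c) < 1))"

context quad_extension
begin

text \<open>The norm of \<open>x + y * \<delta>\<close> is the larger of \<open>N x\<close> and
  \<open>N y\<close>, so no new values arise. Values that are powers of 2 make the later adjunction
  of the square root of 2 ramified.\<close>

lemma dyadic_norm_inert:
  assumes "N (\<delta>\<^sup>2) = 1" "dyadic_norm F N"
  shows "dyadic_norm (quad_field F \<delta>) (quad_norm F N \<delta>)"
  unfolding dyadic_norm_def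
proof
  fix z assume "z \<in> quad_field F \<delta>"
  then obtain x y where m: "x \<in> F" "y \<in> F" and z: "z = x + y * \<delta>"
    unfolding quad_field_def by blast
  have n: "quad_norm F N \<delta> z = max (N x) (N y)" unfolding z quad_norm_max[OF m] by (simp add: assms)
  have d: "N t = 0 \<or> (\<exists>n::int. N t = 2 powr n)" if "t \<in> F" for t
    using assms(2) that N_0 unfolding dyadic_norm_def by auto
  have "quad_norm F N \<delta> z = N x \<or> quad_norm F N \<delta> z = N y" unfolding n by (simp add: max_def)
  then have "quad_norm F N \<delta> z = 0 \<or> (\<exists>n::int. quad_norm F N \<delta> z = 2 powr n)"
    using d m by metis
  moreover have "z = 0" if "quad_norm F N \<delta> z = 0"
  proof -
    have "N x = 0" "N y = 0" using that N_nonneg m unfolding n by (smt (verit))+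
    then show ?thesis using N_eq_0 m z by simp
  qed
  ultimately show "z = 0 \<or> (\<exists>n::int. quad_norm F N \<delta> z = 2 powr n)" by blast
qed

text \<open>Common part of the two cases below. In the square of \<open>x + y * \<delta>\<close> the
  cross term carries a factor 2 and is small; \<open>comb\<close> absorbs the remaining term
  \<open>\<delta>\<^sup>2 * y\<^sup>2\<close> into \<open>C\<close>.\<close>

lemma squares_lift_step:
  assumes 2: "N 2 < 1" and C: "C \<subseteq> F"
    and lift: "squares_lift F N C"
    and le: "\<And>y. y \<in> F \<Longrightarrow> sqrt (N (\<delta>\<^sup>2)) * N y \<le> 1 \<Longrightarrow> N y \<le> 1"
    and d: "N (\<delta>\<^sup>2) \<le> 1"
    and comb: "\<And>x c. x \<in> F \<Longrightarrow> c \<in> C \<Longrightarrow> N x \<le> 1 \<Longrightarrow> \<exists>c'\<in>C. N (c + \<delta>\<^sup>2 * x\<^sup>2 - c') < 1"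
  shows "squares_lift (quad_field F \<delta>) (quad_norm F N \<delta>) C"
  unfolding squares_lift_def
proof (intro ballI impI)
  interpret Q: nonarch_subfield "quad_field F \<delta>" "quad_norm F N \<delta>" by (rule nonarch_subfield_quad)
  let ?N = "quad_norm F N \<delta>"
  fix z assume z: "z \<in> quad_field F \<delta>" "?N z \<le> 1"
  then obtain x y where m: "x \<in> F" "y \<in> F" and zxy: "z = x + y * \<delta>"
    unfolding quad_field_def by blast
  have x: "N x \<le> 1" and y': "sqrt (N (\<delta>\<^sup>2)) * N y \<le> 1"
    using z(2) unfolding zxy quad_norm_max[OF m] by auto
  have y: "N y \<le> 1" using le[OF m(2) y'] .
  obtain c where c: "c \<in> C" "N (x\<^sup>2 - c) < 1"
    using lift m(1) x unfolding squares_lift_def by blast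
  obtain c' where c': "c' \<in> C" "N (c + \<delta>\<^sup>2 * y\<^sup>2 - c') < 1"
    using comb[OF m(2) c(1) y] by blast
  have F: "c \<in> F" "c' \<in> F" using c c' C by auto
  have eq: "z\<^sup>2 - c' = ((x\<^sup>2 - c) + (c + \<delta>\<^sup>2 * y\<^sup>2 - c')) + (2 * x * y) * \<delta>"
    by (simp add: zxy algebra_simps power2_eq_square)
  have mm: "(x\<^sup>2 - c) + (c + \<delta>\<^sup>2 * y\<^sup>2 - c') \<in> F" "2 * x * y \<in> F"
    using m F sq_mem by (simp_all only: mem)
  have "?N (z\<^sup>2 - c') =
      max (N ((x\<^sup>2 - c) + (c + \<delta>\<^sup>2 * y\<^sup>2 - c'))) (sqrt (N (\<delta>\<^sup>2)) * N (2 * x * y))"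
    unfolding eq by (rule quad_norm_max[OF mm])
  moreover have "N ((x\<^sup>2 - c) + (c + \<delta>\<^sup>2 * y\<^sup>2 - c')) < 1"
    using N_add[of "x\<^sup>2 - c" "c + \<delta>\<^sup>2 * y\<^sup>2 - c'"] c(2) c'(2) m F sq_mem by (simp add: mem)
  moreover have "sqrt (N (\<delta>\<^sup>2)) * N (2 * x * y) < 1"
  proof -
    have "N (2 * x * y) = N 2 * (N x * N y)" using m by (simp add: N_mult mem)
    also have "\<dots> \<le> N 2 * 1"
      using x y m N_nonneg two_mem by (intro mult_left_mono mult_le_one) auto
    finally have "N (2 * x * y) < 1" using 2 by simp
    moreover have "sqrt (N (\<delta>\<^sup>2)) \<le> 1" using d by simp
    moreover have "0 \<le> N (2 * x * y)" using N_nonneg mm by blast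
    ultimately show ?thesis using gen_sq_pos
      by (smt (verit) mult_left_le_one_le real_sqrt_gt_zero)
  qed
  ultimately show "\<exists>c\<in>C. ?N (z\<^sup>2 - c) < 1" using c'(1) by (intro bexI[of _ c']) auto
qed

end

section \<open>The norm form over the tower of quadratic extensions\<close>

context quad_extension
begin

text \<open>Here \<open>\<delta>\<^sup>2\<close> lies in \<open>C\<close> and the other factor is a
  square that lifts to \<open>C\<close>, so closure under sums and products suffices.\<close>

lemma squares_lift_inert:
  assumes 2: "N 2 < 1" and C: "C \<subseteq> F" "\<And>x y. x \<in> C \<Longrightarrow> y \<in> C \<Longrightarrow> x + y \<in> C"
      "\<And>x y. x \<in> C \<Longrightarrow> y \<in> C \<Longrightarrow> x * y \<in> C"
    and lift: "squares_lift F N C" and d: "\<delta>\<^sup>2 \<in> C" "N (\<delta>\<^sup>2) = 1"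
  shows "squares_lift (quad_field F \<delta>) (quad_norm F N \<delta>) C"
proof (rule squares_lift_step[OF 2 C(1) lift])
  fix x c assume x: "x \<in> F" "N x \<le> 1" and c: "c \<in> C"
  obtain c' where c': "c' \<in> C" "N (x\<^sup>2 - c') < 1"
    using lift x unfolding squares_lift_def by blast
  have "c + \<delta>\<^sup>2 * x\<^sup>2 - (c + \<delta>\<^sup>2 * c') = \<delta>\<^sup>2 * (x\<^sup>2 - c')" by (simp add: algebra_simps)
  moreover have "N (\<delta>\<^sup>2 * (x\<^sup>2 - c')) = N (\<delta>\<^sup>2) * N (x\<^sup>2 - c')"
    using sq_mem x c'(1) C(1) by (intro N_mult) (auto intro!: mem)
  ultimately show "\<exists>c'\<in>C. N (c + \<delta>\<^sup>2 * x\<^sup>2 - c') < 1"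
    using c c' d C(2,3) by (intro bexI[of _ "c + \<delta>\<^sup>2 * c'"]) simp_all
qed (simp_all add: d)

text \<open>The residue field does not grow, since the contribution of \<delta> is small.
  Integrality bounds \<open>N y\<close> only by the square root of 2; as a power of 2 it is then at
  most 1.\<close>

lemma squares_lift_ramified:
  assumes 2: "N 2 < 1" and C: "C \<subseteq> F"
    and lift: "squares_lift F N C" and dy: "dyadic_norm F N" and d: "N (\<delta>\<^sup>2) = 1 / 2"
  shows "squares_lift (quad_field F \<delta>) (quad_norm F N \<delta>) C"
proof (rule squares_lift_step[OF 2 C lift])
  fix y assume y: "y \<in> F" "sqrt (N (\<delta>\<^sup>2)) * N y \<le> 1"
  show "N y \<le> 1"
  proof (cases "y = 0")
    case False
    then obtain n :: int where n: "N y = 2 powr n"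
      using dy y(1) unfolding dyadic_norm_def by blast
    have "(sqrt (1 / 2) * N y)\<^sup>2 \<le> 1\<^sup>2"
      using y d N_nonneg[OF y(1)] by (intro power_mono) auto
    then have "(N y)\<^sup>2 \<le> 2" by (simp add: power_mult_distrib)
    moreover have "(N y)\<^sup>2 = 2 powr (2 * n)"
      unfolding n by (simp add: power2_eq_square powr_add[symmetric])
    ultimately have "2 powr (2 * n) \<le> (2::real) powr 1" by simp
    then have "real_of_int (2 * n) \<le> 1" by (subst (asm) powr_le_cancel_iff) auto
    then have "n \<le> 0" by linarith
    then show ?thesis unfolding n using powr_mono[of n 0 2] by simp
  qed (simp add: N_0)
next
  fix x c assume x: "x \<in> F" "N x \<le> 1" and c: "c \<in> C"
  have "N (\<delta>\<^sup>2 * x\<^sup>2) = 1 / 2 * (N x)\<^sup>2"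
    using sq_mem x d by (simp add: N_mult N_power2 power2_mem)
  moreover have "(N x)\<^sup>2 \<le> 1" using x N_nonneg[OF x(1)] by (simp add: power_le_one)
  ultimately show "\<exists>c'\<in>C. N (c + \<delta>\<^sup>2 * x\<^sup>2 - c') < 1"
    using c by (intro bexI[of _ c]) simp_all
qed (simp add: d)

end

context nonarch_subfield
begin

text \<open>For nonzero \<open>x\<close> and \<open>y\<close>, the values of
  \<open>x\<^sup>2\<close> and \<open>d * y\<^sup>2\<close> are powers of 2 with even and odd
  exponent. They differ, so the larger one is the value of the difference.\<close>

lemma norm_form_ramified:
  assumes dy: "dyadic_norm F N" and d: "d \<in> F" "N d = 1 / 2" and xy: "x \<in> F" "y \<in> F"
  shows "N (x\<^sup>2 - d * y\<^sup>2) = max ((N x)\<^sup>2) (N d * (N y)\<^sup>2)"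
proof (cases "x = 0 \<or> y = 0")
  case True
  have "N (d * y\<^sup>2) = N d * (N y)\<^sup>2" using d xy by (simp add: N_mult N_power2 power2_mem)
  moreover have "0 \<le> N d * (N y)\<^sup>2" using d(2) by simp
  ultimately show ?thesis using True xy d(1) N_uminus[of "d * y\<^sup>2"]
    by (auto simp: N_0 N_power2 power2_mem mult_mem)
next
  case False
  then obtain m n :: int where mn: "N x = 2 powr m" "N y = 2 powr n"
    using dy xy unfolding dyadic_norm_def by blast
  have sq: "(2 powr t)\<^sup>2 = (2::real) powr (2 * t)" for t
    by (simp add: power2_eq_square powr_add[symmetric])
  have 1: "N (x\<^sup>2) = 2 powr (2 * m)"
    using xy by (simp add: N_power2 mn sq)
  have 2: "N (d * y\<^sup>2) = 2 powr (2 * n - 1)"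
    using xy d by (simp add: N_mult N_power2 power2_mem mn sq powr_diff)
  have m: "x\<^sup>2 \<in> F" "d * y\<^sup>2 \<in> F" using xy d by (simp_all add: mem)
  have e: "(N x)\<^sup>2 = N (x\<^sup>2)" "N d * (N y)\<^sup>2 = N (d * y\<^sup>2)"
    using xy d by (simp_all add: N_mult N_power2 power2_mem)
  have "real_of_int (2 * m) \<noteq> real_of_int (2 * n - 1)" by presburger
  then consider "N (d * y\<^sup>2) < N (x\<^sup>2)" | "N (x\<^sup>2) < N (d * y\<^sup>2)"
    unfolding 1 2 by (metis linorder_neqE_linordered_idom of_int_less_iff powr_less_cancel_iff one_less_numeral_iff semiring_norm(76))
  then show ?thesis
  proof cases
    case 1
    then show ?thesis unfolding e using N_diff_eq[OF m 1] by simp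
  next
    case 2
    then have "N (d * y\<^sup>2 - x\<^sup>2) = N (d * y\<^sup>2)" using N_diff_eq[OF m(2,1)] by simp
    then have "N (x\<^sup>2 - d * y\<^sup>2) = N (d * y\<^sup>2)"
      using N_uminus[of "x\<^sup>2 - d * y\<^sup>2"] m diff_mem by simp
    then show ?thesis unfolding e using 2 by simp
  qed
qed

end

locale nonarch_field = nonarch_subfield UNIV N for N :: "'l::field \<Rightarrow> real"
begin

lemma integral_simps:
  "N x \<le> 1 \<Longrightarrow> N y \<le> 1 \<Longrightarrow> N (x + y) \<le> 1"
  "N x \<le> 1 \<Longrightarrow> N y \<le> 1 \<Longrightarrow> N (x - y) \<le> 1"
  "N x \<le> 1 \<Longrightarrow> N y \<le> 1 \<Longrightarrow> N (x * y) \<le> 1"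
  "N x \<le> 1 \<Longrightarrow> N (x ^ n) \<le> 1"
  "N 1 \<le> 1"
proof -
  show *: "N (x * y) \<le> 1" if "N x \<le> 1" "N y \<le> 1" for x y
    using that N_nonneg by (simp add: N_mult mult_le_one)
  show "N (x ^ n) \<le> 1" if "N x \<le> 1"
    by (induction n) (use that N_1 * in auto)
qed (use N_add[of x y] N_diff[of x y] N_1 in auto)

lemma small_add: "N x < 1 \<Longrightarrow> N y < 1 \<Longrightarrow> N (x + y) < 1"
  using N_add[of x y] by simp

lemma small_mult: "N x < 1 \<Longrightarrow> N y \<le> 1 \<Longrightarrow> N (x * y) < 1"
  using N_nonneg[of x] N_nonneg[of y] mult_left_le[of "N y" "N x"] by (simp add: N_mult)

lemma N_power2_less_1: "N (x\<^sup>2) < 1 \<longleftrightarrow> N x < 1"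
  using N_nonneg[of x] by (simp add: N_power2 power2_less_1_iff)

text \<open>
  Put \<open>\<gamma> = 1 + \<alpha>\<close>, \<open>\<epsilon> = 1 + \<beta>\<close> and \<open>\<pi> = \<surd>2\<close>. In the quaternion algebra \<open>(1 + a, 1 + b)\<close> the elements
  \<open>(i - \<gamma> + \<pi>)/\<pi>\<close> and \<open>(j - \<epsilon> + \<pi>)/\<pi>\<close> are integral; the left hand side of the hypothesis is the
  reduced norm in these coordinates. Modulo the maximal ideal it is
  \<open>P\<^sup>2 + \<gamma>Q\<^sup>2 + \<epsilon>R\<^sup>2 + \<gamma>\<epsilon>QR\<close>, and the conclusion is the square of this form.
\<close>

lemma reduced_norm_residue:
  assumes sq: "\<alpha>\<^sup>2 = a" "\<beta>\<^sup>2 = b" "\<pi>\<^sup>2 = 2" and int: "N a \<le> 1" "N b \<le> 1" and 2: "N 2 < 1"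
    and PQR: "N P \<le> 1" "N Q \<le> 1" "N R \<le> 1"
    and 0: "P\<^sup>2 + (1 + \<alpha>) * (1 - \<pi>) * Q\<^sup>2 + (1 + \<beta>) * (1 - \<pi>) * R\<^sup>2
      - \<pi> * (1 + \<alpha> - \<pi>) * P * Q - \<pi> * (1 + \<beta> - \<pi>) * P * R
      + (1 + \<alpha> - \<pi>) * (1 + \<beta> - \<pi>) * Q * R = 0"
  shows "N ((P\<^sup>2)\<^sup>2 + (1 + a) * (Q\<^sup>2)\<^sup>2 + (1 + b) * (R\<^sup>2)\<^sup>2 + (1 + a) * (1 + b) * (Q\<^sup>2 * R\<^sup>2)) < 1"
proof -
  have root: "N x \<le> 1" if "N (x\<^sup>2) \<le> 1" for x
    using that N_nonneg[of x] by (simp add: N_power2 abs_square_le_1)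
  have i: "N \<alpha> \<le> 1" "N \<beta> \<le> 1" "N \<pi> \<le> 1" "N 2 \<le> 1"
    using root[of \<alpha>] root[of \<beta>] root[of \<pi>] int 2 unfolding sq by simp_all
  define \<gamma> \<epsilon> where "\<gamma> = 1 + \<alpha>" and "\<epsilon> = 1 + \<beta>"
  have ge: "N \<gamma> \<le> 1" "N \<epsilon> \<le> 1" using i by (simp_all add: \<gamma>_def \<epsilon>_def integral_simps)
  \<comment> \<open>\<open>S\<close> is the reduction of the hypothesis modulo \<pi>, and
    \<open>\<pi> * T\<close> is the amount subtracted from it. \<open>E\<close> is half the sum of
    the cross terms of \<open>S\<^sup>2\<close>, and \<open>Z\<close> is half the expression to be
    bounded.\<close>
  define S where "S = P\<^sup>2 + \<gamma> * Q\<^sup>2 + \<epsilon> * R\<^sup>2 + \<gamma> * \<epsilon> * (Q * R)"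
  define T where "T = \<gamma> * Q\<^sup>2 + \<epsilon> * R\<^sup>2 + (\<gamma> - \<pi>) * P * Q + (\<epsilon> - \<pi>) * P * R + (\<gamma> + \<epsilon> - \<pi>) * Q * R"
  define E where "E = \<gamma> * P\<^sup>2 * Q\<^sup>2 + \<epsilon> * P\<^sup>2 * R\<^sup>2 + \<gamma> * \<epsilon> * P\<^sup>2 * Q * R + \<gamma> * \<epsilon> * Q\<^sup>2 * R\<^sup>2
    + \<gamma>\<^sup>2 * \<epsilon> * Q ^ 3 * R + \<gamma> * \<epsilon>\<^sup>2 * Q * R ^ 3"
  define Z where "Z = T\<^sup>2 - E - \<alpha> * Q ^ 4 - \<beta> * R ^ 4
    - (\<alpha> * (1 + b) + \<beta> * (1 + a) + 2 * \<alpha> * \<beta>) * Q\<^sup>2 * R\<^sup>2"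
  have "S - \<pi> * T = P\<^sup>2 + (1 + \<alpha>) * (1 - \<pi>) * Q\<^sup>2 + (1 + \<beta>) * (1 - \<pi>) * R\<^sup>2
      - \<pi> * (1 + \<alpha> - \<pi>) * P * Q - \<pi> * (1 + \<beta> - \<pi>) * P * R
      + (1 + \<alpha> - \<pi>) * (1 + \<beta> - \<pi>) * Q * R"
    unfolding S_def T_def \<gamma>_def \<epsilon>_def by (simp add: algebra_simps power2_eq_square)
  then have "S = \<pi> * T" using 0 by (simp only: right_minus_eq)
  \<comment> \<open>Squaring replaces \<pi> by 2, and up to multiples of 2 it replaces \<gamma> and
    \<epsilon> by \<open>1 + a\<close> and \<open>1 + b\<close>.\<close>
  then have ST: "S\<^sup>2 = 2 * T\<^sup>2" using sq(3) by (simp add: power_mult_distrib)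
  have SE: "S\<^sup>2 = (P\<^sup>2)\<^sup>2 + \<gamma>\<^sup>2 * (Q\<^sup>2)\<^sup>2 + \<epsilon>\<^sup>2 * (R\<^sup>2)\<^sup>2 + \<gamma>\<^sup>2 * \<epsilon>\<^sup>2 * (Q\<^sup>2 * R\<^sup>2) + 2 * E"
    unfolding S_def E_def by (simp add: algebra_simps power2_eq_square power3_eq_cube)
  have g: "\<gamma>\<^sup>2 = 1 + a + 2 * \<alpha>" "\<epsilon>\<^sup>2 = 1 + b + 2 * \<beta>"
    using sq by (simp_all add: \<gamma>_def \<epsilon>_def power2_sum)
  have "(P\<^sup>2)\<^sup>2 + (1 + a) * (Q\<^sup>2)\<^sup>2 + (1 + b) * (R\<^sup>2)\<^sup>2 + (1 + a) * (1 + b) * (Q\<^sup>2 * R\<^sup>2) = 2 * Z"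
    using SE unfolding ST g Z_def power4_eq_xxxx by (simp add: algebra_simps power2_eq_square)
  moreover have "N Z \<le> 1"
    unfolding Z_def T_def E_def
    using i ge int PQR by (simp add: integral_simps)
  ultimately show ?thesis using small_mult[OF 2] by simp
qed

end

text \<open>The bound is shaped for error terms divisible by 2, and it covers \<open>q = 0\<close>
  as well.\<close>

lemma (in nonarch_subfield) N_perturb:
  assumes "q \<in> F" "e \<in> F" "N e \<le> N q / 2"
  shows "N (q + e) = N q"
proof (cases "q = 0")
  case True
  then have "N e = 0" using assms N_0 N_nonneg[of e] by simp
  then show ?thesis using True assms N_eq_0 by simp
next
  case False
  then have "0 < N q" using assms(1) N_eq_0[of q] N_nonneg[of q] by simp
  then show ?thesis using N_add_eq[OF assms(1,2)] assms(3) by simp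
qed

lemma square_max: "0 \<le> s \<Longrightarrow> 0 \<le> t \<Longrightarrow> (max s t)\<^sup>2 = max (s\<^sup>2) (t\<^sup>2)" for s t :: real
  by (auto simp: max_def power_mono intro: antisym)

section \<open>The tower generated by the three square roots\<close>

locale biquadratic_tower = valued_2_basis v \<phi> a b
  for v :: "'k::field_char_0 \<Rightarrow> int" and \<phi> :: "'k set \<Rightarrow> F2_rat2" and a b :: 'k +
  fixes \<iota> :: "'k \<Rightarrow> 'l::field" and sqrt_a sqrt_b sqrt_2 :: 'l
  assumes emb: "field_embedding \<iota>"
    and sqrt: "sqrt_a\<^sup>2 = \<iota> a" "sqrt_b\<^sup>2 = \<iota> b" "sqrt_2\<^sup>2 = \<iota> 2"
    and gen: "generate_field ring_of_type_algebra (range \<iota> \<union> {sqrt_a, sqrt_b, sqrt_2}) = UNIV"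
begin

lemmas emb_simps = field_embedding_simps[OF emb]

lemma emb_uminus: "\<iota> (- x) = - \<iota> x"
  using emb_simps(5)[of 0 x] by (simp add: emb_simps)

lemma emb_power2: "\<iota> (x\<^sup>2) = (\<iota> x)\<^sup>2"
  by (simp add: power2_eq_square emb_simps)

lemma emb_two: "\<iota> 2 = 2"
  using emb_simps(2)[of 1 1] by (simp add: emb_simps)

lemma emb_inverse: "\<iota> (inverse x) = inverse (\<iota> x)"
proof (cases "x = 0")
  case False
  then have "\<iota> x * \<iota> (inverse x) = 1" by (simp add: emb_simps(1)[symmetric] emb_simps(3))
  then show ?thesis by (metis inverse_unique)
qed (simp add: emb_simps)

lemma emb_inj: "inj \<iota>"
proof (rule injI)
  fix x y assume "\<iota> x = \<iota> y"
  then show "x = y" using emb_simps(5)[of x y] emb_simps(6)[of "x - y"] by simp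
qed

definition norm_0 :: "'l \<Rightarrow> real"
  where "norm_0 z = val_abs v (inv_into UNIV \<iota> z)"

lemma norm_0_eq: "norm_0 (\<iota> x) = val_abs v x"
  by (simp add: norm_0_def emb_inj)

lemma nonarch_0: "nonarch_subfield (range \<iota>) norm_0"
proof
  show "1 \<in> range \<iota>" by (metis emb_simps(3) rangeI)
next
  fix z w assume "z \<in> range \<iota>" "w \<in> range \<iota>"
  then obtain x y where z: "z = \<iota> x" and w: "w = \<iota> y" by blast
  show "z - w \<in> range \<iota>" "z * w \<in> range \<iota>" unfolding z w
    by (simp_all flip: emb_simps(1,5))
  show "norm_0 (z * w) = norm_0 z * norm_0 w" "norm_0 (z + w) \<le> max (norm_0 z) (norm_0 w)"
    unfolding z w using K.N_mult[of x y] K.N_add[of x y]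
    by (simp_all add: norm_0_eq flip: emb_simps(1,2))
next
  fix z assume "z \<in> range \<iota>"
  then obtain x where z: "z = \<iota> x" by blast
  show "0 \<le> norm_0 z" "norm_0 z = 0 \<longleftrightarrow> z = 0"
    unfolding z using K.N_nonneg[of x] K.N_eq_0[of x] by (simp_all add: norm_0_eq emb_simps)
  show "inverse z \<in> range \<iota>" unfolding z by (simp flip: emb_inverse)
qed

lemma val_abs_a: "val_abs v a = 1" and val_abs_b: "val_abs v b = 1"
  using val_abs_basis_form[of 0 1 0 0] val_abs_basis_form[of 0 0 1 0] K.N_0 K.N_1
  by (simp_all add: basis_form_def)

lemma ab_neq_0: "a \<noteq> 0" "b \<noteq> 0"
  using val_abs_a val_abs_b K.N_0 by auto

lemma sqrt_neq_0: "sqrt_a \<noteq> 0" "sqrt_b \<noteq> 0" "sqrt_2 \<noteq> 0"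
  using sqrt ab_neq_0 emb_simps(6) by (metis zero_power2 zero_neq_numeral)+

text \<open>Modulo 2 the sign of \<open>a\<close> is irrelevant: the norm form differs from the
  basis form at \<open>x, y, 0, 0\<close> by \<open>2 * (a * y\<^sup>2)\<close>, too small to change
  its value.\<close>

lemma quad_a: "quad_extension (range \<iota>) norm_0 sqrt_a"
proof -
  interpret nonarch_subfield "range \<iota>" norm_0 by (rule nonarch_0)
  show ?thesis
  proof
    show "sqrt_a\<^sup>2 \<in> range \<iota>" by (simp add: sqrt)
    show "sqrt_a \<noteq> 0" by (rule sqrt_neq_0)
    fix z w assume "z \<in> range \<iota>" "w \<in> range \<iota>"
    then obtain x y where z: "z = \<iota> x" and w: "w = \<iota> y" by blast
    let ?M = "max (val_abs v x) (val_abs v y)"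
    have M: "val_abs v (basis_form x y 0 0) = ?M\<^sup>2"
      using K.N_nonneg[of y] by (simp add: val_abs_basis_form K.N_0)
    have "val_abs v (- (2 * (a * y\<^sup>2))) = (val_abs v y)\<^sup>2 / 2"
      by (simp add: K.N_uminus K.N_mult K.N_power2 val_abs_2 val_abs_a)
    moreover have "(val_abs v y)\<^sup>2 \<le> ?M\<^sup>2" using K.N_nonneg[of y] by (simp add: power_mono)
    ultimately have "val_abs v (basis_form x y 0 0 + - (2 * (a * y\<^sup>2))) = ?M\<^sup>2"
      using M by (subst K.N_perturb) auto
    moreover have "z\<^sup>2 - sqrt_a\<^sup>2 * w\<^sup>2 = \<iota> (basis_form x y 0 0 + - (2 * (a * y\<^sup>2)))"
      by (simp add: z w sqrt basis_form_def emb_power2[symmetric] emb_simps(1,5)[symmetric])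
    ultimately show "norm_0 (z\<^sup>2 - sqrt_a\<^sup>2 * w\<^sup>2) = max ((norm_0 z)\<^sup>2) (norm_0 (sqrt_a\<^sup>2) * (norm_0 w)\<^sup>2)"
      using K.N_nonneg by (simp add: z w sqrt norm_0_eq val_abs_a square_max)
  qed
qed

definition "field_1 = quad_field (range \<iota>) sqrt_a"
definition "norm_1 = quad_norm (range \<iota>) norm_0 sqrt_a"

lemma nonarch_1: "nonarch_subfield field_1 norm_1"
  unfolding field_1_def norm_1_def by (rule quad_extension.nonarch_subfield_quad[OF quad_a])

lemma norm_1_max: "norm_1 (\<iota> x + \<iota> y * sqrt_a) = max (val_abs v x) (val_abs v y)"
  unfolding norm_1_def using quad_extension.quad_norm_max[OF quad_a, of "\<iota> x" "\<iota> y"]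
  by (simp add: norm_0_eq sqrt val_abs_a)

lemma norm_1_eq: "norm_1 (\<iota> x) = val_abs v x"
  unfolding norm_1_def using quad_extension.quad_norm_base[OF quad_a, of "\<iota> x"]
  by (simp add: norm_0_eq)

text \<open>Writing \<open>z\<close> and \<open>w\<close> in coordinates over the base field, the
  norm form is the basis form in these four coordinates plus the multiple of 2 given by
  \<open>c0\<close> and \<open>c1\<close>.\<close>

lemma quad_b: "quad_extension field_1 norm_1 sqrt_b"
proof -
  interpret F1: nonarch_subfield field_1 norm_1 by (rule nonarch_1)
  have F1: "\<iota> x + \<iota> y * sqrt_a \<in> field_1" for x y
    unfolding field_1_def quad_field_def by blast
  show ?thesis
  proof
    show "sqrt_b\<^sup>2 \<in> field_1" using F1[of b 0] by (simp add: sqrt emb_simps)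
    show "sqrt_b \<noteq> 0" by (rule sqrt_neq_0)
    fix z w assume "z \<in> field_1" "w \<in> field_1"
    then obtain x0 x1 y0 y1 where z: "z = \<iota> x0 + \<iota> x1 * sqrt_a" and w: "w = \<iota> y0 + \<iota> y1 * sqrt_a"
      unfolding field_1_def quad_field_def by blast
    let ?M = "Max {val_abs v x0, val_abs v x1, val_abs v y0, val_abs v y1}"
    define c0 where "c0 = - (b * y0\<^sup>2 + a * b * y1\<^sup>2)"
    define c1 where "c1 = x0 * x1 - b * y0 * y1"
    have le: "val_abs v x0 \<le> ?M" "val_abs v x1 \<le> ?M" "val_abs v y0 \<le> ?M" "val_abs v y1 \<le> ?M"
      by auto
    have prod: "val_abs v s * val_abs v t \<le> ?M\<^sup>2" if "val_abs v s \<le> ?M" "val_abs v t \<le> ?M" for s t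
      unfolding power2_eq_square using that K.N_nonneg[OF UNIV_I, of s] K.N_nonneg[OF UNIV_I, of t]
      by (intro mult_mono) linarith+
    have "val_abs v c0 \<le> max (val_abs v (b * y0\<^sup>2)) (val_abs v (a * b * y1\<^sup>2))"
      unfolding c0_def using K.N_add[of "b * y0\<^sup>2" "a * b * y1\<^sup>2"] by (simp only: K.N_uminus UNIV_I)
    also have "\<dots> \<le> ?M\<^sup>2"
      using prod[OF le(3,3)] prod[OF le(4,4)]
      by (simp only: K.N_mult power2_eq_square UNIV_I val_abs_a val_abs_b mult_1 max.bounded_iff)
    finally have c0: "val_abs v c0 \<le> ?M\<^sup>2" .
    have "val_abs v c1 \<le> max (val_abs v (x0 * x1)) (val_abs v (b * y0 * y1))"
      unfolding c1_def by (rule K.N_diff) simp_all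
    also have "\<dots> \<le> ?M\<^sup>2"
      using prod[OF le(1,2)] prod[OF le(3,4)]
      by (simp only: K.N_mult UNIV_I val_abs_b mult_1 max.bounded_iff)
    finally have c1: "val_abs v c1 \<le> ?M\<^sup>2" .
    let ?q = "\<iota> (basis_form x0 x1 y0 y1)"
    let ?e = "\<iota> (2 * c0) + \<iota> (2 * c1) * sqrt_a"
    have "?q \<in> field_1" using F1[of _ 0] by (simp add: emb_simps)
    moreover have "norm_1 ?e \<le> norm_1 ?q / 2"
      unfolding norm_1_max norm_1_eq val_abs_basis_form using c0 c1
      by (simp only: K.N_mult UNIV_I val_abs_2)
    ultimately have "norm_1 (?q + ?e) = norm_1 ?q"
      using F1 by (intro F1.N_perturb) auto
    moreover have sa: "sqrt_a * sqrt_a = \<iota> a" "sqrt_a * (sqrt_a * x) = \<iota> a * x" for x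
      using sqrt(1) by (simp_all add: power2_eq_square mult.assoc[symmetric])
    have "?q + ?e = z\<^sup>2 - sqrt_b\<^sup>2 * w\<^sup>2"
      unfolding z w sqrt(2) c0_def c1_def basis_form_def
      by (simp add: emb_simps emb_uminus emb_power2 emb_two algebra_simps power2_eq_square sa)
    moreover have "norm_1 ?q = max ((norm_1 z)\<^sup>2) ((norm_1 w)\<^sup>2)"
    proof -
      have "?M = max (norm_1 z) (norm_1 w)"
        unfolding z w norm_1_max by (simp add: max.assoc)
      then show ?thesis
        unfolding norm_1_eq val_abs_basis_form
        using square_max[of "norm_1 z" "norm_1 w"] F1.N_nonneg F1 z w by simp
    qed
    ultimately show "norm_1 (z\<^sup>2 - sqrt_b\<^sup>2 * w\<^sup>2) = max ((norm_1 z)\<^sup>2) (norm_1 (sqrt_b\<^sup>2) * (norm_1 w)\<^sup>2)"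
      by (simp add: sqrt norm_1_eq val_abs_b)
  qed
qed

definition "field_2 = quad_field field_1 sqrt_b"
definition "norm_2 = quad_norm field_1 norm_1 sqrt_b"

lemma nonarch_2: "nonarch_subfield field_2 norm_2"
  unfolding field_2_def norm_2_def by (rule quad_extension.nonarch_subfield_quad[OF quad_b])

lemma emb_mem_1: "\<iota> x \<in> field_1"
  unfolding field_1_def using quad_extension.base_subset[OF quad_a] by blast

lemma emb_mem_2: "\<iota> x \<in> field_2"
  unfolding field_2_def using quad_extension.base_subset[OF quad_b] emb_mem_1 by blast

lemma norm_2_eq: "norm_2 (\<iota> x) = val_abs v x"
  unfolding norm_2_def using quad_extension.quad_norm_base[OF quad_b] emb_mem_1 norm_1_eq by simp

lemma dyadic_norm_2: "dyadic_norm field_2 norm_2"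
proof -
  have "dyadic_norm (range \<iota>) norm_0"
    unfolding dyadic_norm_def
  proof (rule ballI)
    fix z assume "z \<in> range \<iota>"
    then obtain x where z: "z = \<iota> x" by blast
    show "z = 0 \<or> (\<exists>n::int. norm_0 z = 2 powr n)"
      unfolding z norm_0_eq emb_simps(6)
      by (cases "x = 0") (auto simp: val_abs_def intro!: exI[of _ "- v x"])
  qed
  then have "dyadic_norm field_1 norm_1"
    unfolding field_1_def norm_1_def
    by (intro quad_extension.dyadic_norm_inert[OF quad_a]) (simp_all add: sqrt norm_0_eq val_abs_a)
  then show ?thesis
    unfolding field_2_def norm_2_def
    by (intro quad_extension.dyadic_norm_inert[OF quad_b]) (simp_all add: sqrt norm_1_eq val_abs_b)
qed

lemma quad_2: "quad_extension field_2 norm_2 sqrt_2"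
proof -
  interpret F2: nonarch_subfield field_2 norm_2 by (rule nonarch_2)
  show ?thesis
  proof
    show "sqrt_2\<^sup>2 \<in> field_2" by (simp add: sqrt emb_mem_2)
    show "sqrt_2 \<noteq> 0" by (rule sqrt_neq_0)
    fix z w assume "z \<in> field_2" "w \<in> field_2"
    then show "norm_2 (z\<^sup>2 - sqrt_2\<^sup>2 * w\<^sup>2) = max ((norm_2 z)\<^sup>2) (norm_2 (sqrt_2\<^sup>2) * (norm_2 w)\<^sup>2)"
      by (intro F2.norm_form_ramified dyadic_norm_2)
        (simp_all add: sqrt emb_mem_2 norm_2_eq val_abs_2)
  qed
qed

definition "norm_3 = quad_norm field_2 norm_2 sqrt_2"

text \<open>The set is a subfield containing all generators. This makes \<open>norm_3\<close> an
  absolute value on the whole type.\<close>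

lemma quad_field_UNIV: "quad_field field_2 sqrt_2 = UNIV"
proof -
  interpret F3: nonarch_subfield "quad_field field_2 sqrt_2" norm_3
    unfolding norm_3_def by (rule quad_extension.nonarch_subfield_quad[OF quad_2])
  interpret R: field "ring_of_type_algebra :: 'l ring" by (rule field_from_type_algebra)
  have sub: "field_2 \<subseteq> quad_field field_2 sqrt_2" "field_1 \<subseteq> field_2"
    unfolding field_2_def using quad_extension.base_subset quad_2 quad_b
    by (auto simp: field_2_def)
  have "sqrt_a \<in> field_1" "sqrt_b \<in> field_2" "sqrt_2 \<in> quad_field field_2 sqrt_2"
    using quad_extension.gen_mem quad_a quad_b quad_2 unfolding field_1_def field_2_def by auto
  then have gens: "h \<in> quad_field field_2 sqrt_2" if "h \<in> range \<iota> \<union> {sqrt_a, sqrt_b, sqrt_2}" for h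
    using that sub emb_mem_2 by auto
  have car: "carrier (ring_of_type_algebra :: 'l ring) = UNIV"
    by (simp add: ring_of_type_algebra_def)
  have uminus: "\<ominus>\<^bsub>ring_of_type_algebra\<^esub> x = - x" for x :: 'l
    by (rule R.minus_equality) (auto simp: ring_of_type_algebra_def)
  have inv: "inv\<^bsub>ring_of_type_algebra\<^esub> x = inverse x" if "x \<noteq> 0" for x :: 'l
    by (rule R.comm_inv_char) (use that in \<open>auto simp: ring_of_type_algebra_def\<close>)
  have "z \<in> quad_field field_2 sqrt_2"
    if "z \<in> generate_field ring_of_type_algebra (range \<iota> \<union> {sqrt_a, sqrt_b, sqrt_2})" for z
    using that
  proof (induction rule: generate_field.induct)
    case one
    then show ?case using F3.one_mem by (simp add: ring_of_type_algebra_def)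
  next
    case (incl h)
    then show ?case by (rule gens)
  next
    case (a_inv h)
    then show ?case by (simp add: uminus F3.uminus_mem)
  next
    case (m_inv h)
    then have "h \<noteq> 0" by (simp add: ring_of_type_algebra_def)
    then show ?case using m_inv inv F3.inverse_mem by simp
  next
    case (eng_add h1 h2)
    then show ?case using F3.add_mem by (simp add: ring_of_type_algebra_def)
  next
    case (eng_mult h1 h2)
    then show ?case using F3.mult_mem by (simp add: ring_of_type_algebra_def)
  qed
  then show ?thesis using gen by blast
qed

sublocale L: nonarch_field norm_3
  unfolding nonarch_field_def norm_3_def quad_field_UNIV[symmetric]
  by (rule quad_extension.nonarch_subfield_quad[OF quad_2])

lemma norm_3_eq: "norm_3 (\<iota> x) = val_abs v x"
  unfolding norm_3_def using quad_extension.quad_norm_base[OF quad_2] emb_mem_2 norm_2_eq by simp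

text \<open>Squares in the residue field of the extension come from the residue field of the base:
  the two inert steps and the ramified step preserve this.\<close>

lemma squares_lift_3: "squares_lift UNIV norm_3 (\<iota> ` {c. val_ge v 0 c})"
proof -
  let ?C = "\<iota> ` {c. val_ge v 0 c}"
  have add: "x + y \<in> ?C" and mult: "x * y \<in> ?C" if xy: "x \<in> ?C" "y \<in> ?C" for x y
  proof -
    obtain c d where cd: "x = \<iota> c" "y = \<iota> d" "val_ge v 0 c" "val_ge v 0 d" using xy by blast
    then show "x + y \<in> ?C" "x * y \<in> ?C"
      by (auto simp: val_ge_simps simp flip: emb_simps(1,2))
  qed
  have "squares_lift (range \<iota>) norm_0 ?C"
    unfolding squares_lift_def
  proof (intro ballI impI)
    fix z assume "z \<in> range \<iota>" and n: "norm_0 z \<le> 1"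
    then obtain x where z: "z = \<iota> x" by blast
    have "val_ge v 0 (x\<^sup>2)" using n int_power2 by (simp add: z norm_0_eq val_abs_le_1)
    moreover have "norm_0 (z\<^sup>2 - \<iota> (x\<^sup>2)) < 1"
      using norm_0_eq[of 0] by (simp add: z emb_power2 emb_simps K.N_0)
    ultimately show "\<exists>c\<in>?C. norm_0 (z\<^sup>2 - c) < 1" by blast
  qed
  then have "squares_lift field_1 norm_1 ?C"
    unfolding field_1_def norm_1_def
    by (intro quad_extension.squares_lift_inert[OF quad_a])
      (use norm_0_eq[of 2] int_a add mult in \<open>auto simp: sqrt norm_0_eq val_abs_a val_abs_2 emb_two\<close>)
  then have "squares_lift field_2 norm_2 ?C"
    unfolding field_2_def norm_2_def
    by (intro quad_extension.squares_lift_inert[OF quad_b])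
      (use norm_1_eq[of 2] int_b add mult emb_mem_1 in
        \<open>auto simp: sqrt norm_1_eq val_abs_b val_abs_2 emb_two\<close>)
  then have "squares_lift (quad_field field_2 sqrt_2) norm_3 ?C"
    unfolding norm_3_def
    by (intro quad_extension.squares_lift_ramified[OF quad_2])
      (use norm_2_eq[of 2] emb_mem_2 dyadic_norm_2 in
        \<open>auto simp: sqrt norm_2_eq val_abs_2 emb_two\<close>)
  then show ?thesis by (simp only: quad_field_UNIV)
qed

lemma norm_anisotropic:
  assumes 0: "p\<^sup>2 - \<iota> (1 + a) * q\<^sup>2 - \<iota> (1 + b) * r\<^sup>2 = 0"
  shows "p = 0 \<and> q = 0 \<and> r = 0"
proof -
  \<comment> \<open>The coordinates of \<open>p + q i + r j\<close> with respect to the integral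
    elements \<open>1\<close>, \<open>(i - \<gamma> + \<pi>) / \<pi>\<close> and
    \<open>(j - \<epsilon> + \<pi>) / \<pi>\<close>, where \<open>\<pi>\<close> is
    \<open>sqrt_2\<close>.\<close>
  define P where "P = p + (1 + sqrt_a - sqrt_2) * q + (1 + sqrt_b - sqrt_2) * r"
  define Q where "Q = sqrt_2 * q"
  define R where "R = sqrt_2 * r"
  define form where "form = (\<lambda>P Q R. P\<^sup>2 + (1 + sqrt_a) * (1 - sqrt_2) * Q\<^sup>2 + (1 + sqrt_b) * (1 - sqrt_2) * R\<^sup>2
      - sqrt_2 * (1 + sqrt_a - sqrt_2) * P * Q - sqrt_2 * (1 + sqrt_b - sqrt_2) * P * R
      + (1 + sqrt_a - sqrt_2) * (1 + sqrt_b - sqrt_2) * Q * R)"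
  have form_scale: "form (c * P) (c * Q) (c * R) = c\<^sup>2 * form P Q R" for c P Q R
    by (simp add: form_def algebra_simps power2_eq_square)
  have s2: "sqrt_2 * sqrt_2 = 2" "sqrt_2 * (sqrt_2 * x) = 2 * x" for x
    using sqrt(3) by (simp_all add: emb_two power2_eq_square mult.assoc[symmetric])
  have "form P Q R = p\<^sup>2 - (1 + sqrt_a\<^sup>2) * q\<^sup>2 - (1 + sqrt_b\<^sup>2) * r\<^sup>2"
    unfolding form_def P_def Q_def R_def by (simp add: algebra_simps power2_eq_square s2)
  then have form_0: "form P Q R = 0"
    using 0 by (simp add: sqrt emb_simps)
  have small: "norm_3 P < 1 \<and> norm_3 Q < 1 \<and> norm_3 R < 1"
    if i: "norm_3 P \<le> 1" "norm_3 Q \<le> 1" "norm_3 R \<le> 1" and f: "form P Q R = 0" for P Q R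
  proof -
    have lift: "\<exists>c. val_ge v 0 c \<and> norm_3 (x\<^sup>2 - \<iota> c) < 1" if "norm_3 x \<le> 1" for x
      using squares_lift_3 that unfolding squares_lift_def by auto
    obtain cP cQ cR where c: "val_ge v 0 cP" "val_ge v 0 cQ" "val_ge v 0 cR"
      and s: "norm_3 (P\<^sup>2 - \<iota> cP) < 1" "norm_3 (Q\<^sup>2 - \<iota> cQ) < 1" "norm_3 (R\<^sup>2 - \<iota> cR) < 1"
      using lift[OF i(1)] lift[OF i(2)] lift[OF i(3)] by (elim exE conjE)
    let ?W = "(P\<^sup>2)\<^sup>2 + (1 + \<iota> a) * (Q\<^sup>2)\<^sup>2 + (1 + \<iota> b) * (R\<^sup>2)\<^sup>2 + (1 + \<iota> a) * (1 + \<iota> b) * (Q\<^sup>2 * R\<^sup>2)"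
    \<comment> \<open>The form over the base field, with \<open>cP\<close>, \<open>cQ\<close>,
      \<open>cR\<close> replacing the squares and the fourth variable 0.\<close>
    let ?k = "kummer_form (1 + a) (1 + b) (of_bool True) cP cQ cR 0"
    have n2: "norm_3 2 < 1" using norm_3_eq[of 2] by (simp add: emb_two val_abs_2)
    have ab: "norm_3 (\<iota> a) \<le> 1" "norm_3 (\<iota> b) \<le> 1" by (simp_all add: norm_3_eq val_abs_a val_abs_b)
    have W: "norm_3 ?W < 1"
      by (rule L.reduced_norm_residue[OF sqrt(1,2) sqrt(3)[unfolded emb_two] ab n2 i])
        (use f in \<open>simp add: form_def\<close>)
    have ci: "norm_3 (\<iota> cP) \<le> 1" "norm_3 (\<iota> cQ) \<le> 1" "norm_3 (\<iota> cR) \<le> 1"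
      using c by (simp_all add: norm_3_eq val_abs_le_1)
    \<comment> \<open>The change from replacing the squares by their lifts; every summand contains
      one of the small differences \<open>s\<close>.\<close>
    let ?D = "(P\<^sup>2 - \<iota> cP) * (P\<^sup>2 + \<iota> cP) + (Q\<^sup>2 - \<iota> cQ) * ((1 + \<iota> a) * (Q\<^sup>2 + \<iota> cQ))
      + (R\<^sup>2 - \<iota> cR) * ((1 + \<iota> b) * (R\<^sup>2 + \<iota> cR))
      + ((Q\<^sup>2 - \<iota> cQ) * ((1 + \<iota> a) * (1 + \<iota> b) * R\<^sup>2)
        + (R\<^sup>2 - \<iota> cR) * ((1 + \<iota> a) * (1 + \<iota> b) * \<iota> cQ))"
    have D: "norm_3 ?D < 1"
      using s i ci ab by (intro L.small_add L.small_mult) (simp_all add: L.integral_simps)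
    have "\<iota> ?k = ?W - ?D"
      by (simp add: kummer_form_def emb_simps emb_power2 algebra_simps power2_eq_square)
    then have "norm_3 (\<iota> ?k) < 1" using L.N_diff[of ?W ?D] W D by simp
    then have "val_ge v 1 ?k" by (simp only: norm_3_eq val_abs_less_1)
    then have "val_ge v 1 cP \<and> val_ge v 1 cQ \<and> val_ge v 1 cR"
      using kummer_form_residue[OF c, of 0 True] by (simp add: val_ge_simps)
    then have cs: "norm_3 (\<iota> cP) < 1" "norm_3 (\<iota> cQ) < 1" "norm_3 (\<iota> cR) < 1"
      by (simp_all add: norm_3_eq val_abs_less_1)
    show ?thesis
      using L.small_add[OF s(1) cs(1)] L.small_add[OF s(2) cs(2)] L.small_add[OF s(3) cs(3)]
      by (simp add: L.N_power2_less_1)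
  qed
  \<comment> \<open>Division by a nonzero coordinate of maximal value would give an integral zero
    with a coordinate equal to 1, contrary to \<open>small\<close>.\<close>
  have all_0: "c = 0"
    if c: "c \<in> {P, Q, R}" and le: "norm_3 P \<le> norm_3 c" "norm_3 Q \<le> norm_3 c" "norm_3 R \<le> norm_3 c" for c
  proof (rule ccontr)
    assume "c \<noteq> 0"
    then have pos: "0 < norm_3 c" using L.N_eq_0[OF UNIV_I, of c] L.N_nonneg[OF UNIV_I, of c] by simp
    have n: "norm_3 (inverse c * t) = norm_3 t / norm_3 c" for t
      using L.N_mult[of "inverse c" t] L.N_inverse[of c] \<open>c \<noteq> 0\<close> by (simp add: divide_inverse)
    have "norm_3 (inverse c * P) < 1 \<and> norm_3 (inverse c * Q) < 1 \<and> norm_3 (inverse c * R) < 1"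
      by (rule small) (use le pos in \<open>simp_all add: n form_scale form_0\<close>)
    then show False using c pos by (auto simp: n)
  qed
  have "P = 0 \<and> Q = 0 \<and> R = 0"
  proof -
    have nz: "t = 0" if "norm_3 t \<le> norm_3 0" for t
      using that L.N_nonneg[OF UNIV_I, of t] L.N_eq_0[OF UNIV_I, of t] by (simp add: L.N_0)
    consider "norm_3 Q \<le> norm_3 P" "norm_3 R \<le> norm_3 P" | "norm_3 P \<le> norm_3 Q" "norm_3 R \<le> norm_3 Q"
      | "norm_3 P \<le> norm_3 R" "norm_3 Q \<le> norm_3 R" by linarith
    then show ?thesis
    proof cases
      case 1
      then have "P = 0" using all_0[of P] by simp
      then show ?thesis using 1 nz by simp
    next
      case 2
      then have "Q = 0" using all_0[of Q] by simp
      then show ?thesis using 2 nz by simp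
    next
      case 3
      then have "R = 0" using all_0[of R] by simp
      then show ?thesis using 3 nz by simp
    qed
  qed
  then show ?thesis using sqrt_neq_0(3) by (auto simp: P_def Q_def R_def)
qed

end

section \<open>Survival of the symbol \<open>{1 + a, 1 + b}\<close> under restriction\<close>

theorem theorem7p2:
  fixes v :: "'k::field_char_0 \<Rightarrow> int"
    and \<phi> :: "'k set \<Rightarrow> F2_rat2"
    and a b :: 'k
    and \<iota> :: "'k \<Rightarrow> 'l::field"
    and sqrt_a sqrt_b sqrt_2 :: 'l
  assumes "complete_discrete_valued_field v"
    and "v 2 = 1"
    and "\<phi> \<in> ring_iso (residue_field v) ring_of_type_algebra"
    and "a \<in> carrier (valuation_ring v)" and "\<phi> (residue_class v a) = F2_indet_a"
    and "b \<in> carrier (valuation_ring v)" and "\<phi> (residue_class v b) = F2_indet_b"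
    and "field_embedding \<iota>"
    and "sqrt_a ^ 2 = \<iota> a" and "sqrt_b ^ 2 = \<iota> b" and "sqrt_2 ^ 2 = \<iota> 2"
    and "generate_field ring_of_type_algebra (range \<iota> \<union> {sqrt_a, sqrt_b, sqrt_2}) = UNIV"
  shows "\<exists>x \<in> carrier (milnor_K2_mod2 TYPE('k)).
    restriction_K2_mod2 \<iota> x \<noteq> \<one>\<^bsub>milnor_K2_mod2 TYPE('l)\<^esub>"
proof -
  interpret discrete_valued_field v using assms(1) by (rule complete_discrete_valued_field.axioms)
  interpret residue_iso v \<phi> by unfold_locales (rule assms(3))
  interpret biquadratic_tower v \<phi> a b \<iota> sqrt_a sqrt_b sqrt_2
    using assms by unfold_locales
      (simp_all add: res_def valuation_ring_def ring_of_type_algebra_def)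
  let ?K = "milnor_K2 TYPE('k)" and ?L = "milnor_K2 TYPE('l)"
  interpret K2: comm_group ?K by (rule comm_group_milnor_K2)
  interpret L2: comm_group ?L by (rule comm_group_milnor_K2)
  interpret DK: normal "doubles ?K" ?K by (rule normal_doubles[OF comm_group_milnor_K2])
  interpret DL: normal "doubles ?L" ?L by (rule normal_doubles[OF comm_group_milnor_K2])
  interpret h: group_hom ?K ?L "restriction_K2 \<iota>"
    by unfold_locales (rule restriction_K2_hom[OF emb])
  \<comment> \<open>\<open>1 + a\<close> and \<open>1 + b\<close> are the values of the anisotropic
    form at two unit vectors.\<close>
  have nz: "1 + a \<noteq> 0" "1 + b \<noteq> 0"
    using kummer_form_residue[of 0 1 0 0 True] kummer_form_residue[of 0 0 1 0 True]
    by (auto simp: kummer_form_def val_ge_simps val_ge_def[of v 1 1] val_one)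
  have sym: "milnor_symbol x y \<in> carrier (milnor_K2 TYPE('m))" if "x \<noteq> 0" "y \<noteq> 0" for x y :: "'m::field"
  proof -
    have "frag_of (x, y) \<in> carrier (symbol_group TYPE('m))" using that by (simp add: symbol_group_def)
    then show ?thesis
      unfolding milnor_symbol_def milnor_K2_def FactGroup_def RCOSETS_def by auto
  qed
  let ?s = "milnor_symbol (1 + a) (1 + b)"
  have s: "?s \<in> carrier ?K" using sym nz by blast
  have "restriction_K2 \<iota> ` doubles ?K \<subseteq> doubles ?L"
    by (auto simp: doubles_def h.hom_nat_pow)
  then have "restriction_K2_mod2 \<iota> (doubles ?K #>\<^bsub>?K\<^esub> ?s) = doubles ?L #>\<^bsub>?L\<^esub> restriction_K2 \<iota> ?s"
    unfolding restriction_K2_mod2_def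
    by (rule quot_map_coset[OF K2.is_group L2.is_group restriction_K2_hom[OF emb]
          DK.subgroup_axioms DL.subgroup_axioms _ s])
  also have "restriction_K2 \<iota> ?s = milnor_symbol (\<iota> (1 + a)) (\<iota> (1 + b))"
    by (rule restriction_K2_symbol[OF emb nz])
  finally have res: "restriction_K2_mod2 \<iota> (doubles ?K #>\<^bsub>?K\<^esub> ?s) =
      doubles ?L #>\<^bsub>?L\<^esub> milnor_symbol (\<iota> (1 + a)) (\<iota> (1 + b))" .
  have nz': "\<iota> (1 + a) \<noteq> 0" "\<iota> (1 + b) \<noteq> 0" using nz emb_simps(6) by blast+
  have "(2::'l) \<noteq> 0" using emb_simps(6)[of 2] by (simp add: emb_two)
  from milnor_symbol_doubles_isotropic[OF this nz'] norm_anisotropic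
  have "milnor_symbol (\<iota> (1 + a)) (\<iota> (1 + b)) \<notin> doubles ?L" by blast
  \<comment> \<open>If the coset were the identity \<open>doubles ?L\<close>, that subgroup would
    contain the symbol.\<close>
  then have "restriction_K2_mod2 \<iota> (doubles ?K #>\<^bsub>?K\<^esub> ?s) \<noteq> \<one>\<^bsub>milnor_K2_mod2 TYPE('l)\<^esub>"
    unfolding res using L2.rcos_self[OF sym[OF nz'] DL.subgroup_axioms]
    by (auto simp: milnor_K2_mod2_def FactGroup_def)
  moreover have "doubles ?K #>\<^bsub>?K\<^esub> ?s \<in> carrier (milnor_K2_mod2 TYPE('k))"
    using s by (auto simp: milnor_K2_mod2_def FactGroup_def RCOSETS_def)
  ultimately show ?thesis by blast
qed

end
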